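(* Let $\mathcal{A}$ be a unique factorization domain, $n\ge2$, $m\ge1$. Let $\mathbb{T}_{n,m}$ be the following tree: a path ("spine") $v_1,\dots,v_m$; a leaf $t_0$ adjacent to $v_1$; a leaf $t_{\rm head}$ adjacent to $v_m$; and further leaves attached so that every spine vertex $v_s$ has degree exactly $n$. Each edge is labeled by an element of $[n]=\{1,\dots,n\}$ so that the $n$ edges at each spine vertex have distinct labels; write $t\overset{k}{-}t'$ for an edge labeled $k$. The edges $v_s v_{s+1}$ are oriented $v_s\to v_{s+1}$ (away from $t_0$). To each edge $t\overset{k}{-}t'$ is assigned a nonzero polynomial $P\in\mathcal{A}[x_1,\dots,x_n]$ (its exchange polynomial). Let $x_1(t_0),\dots,x_n(t_0)$ be independent indeterminates, and define elements $x_1(t),\dots,x_n(t)$ of $\mathcal{A}(x_1(t_0),\dots,x_n(t_0))$ for every vertex $t$ by the rules: for every edge $t\overset{k}{-}t'$ with exchange polynomial $P$, $x_i(t)=x_i(t')$ for $i\ne k$ and $x_k(t)x_k(t')=P(x_1(t),\dots,x_n(t))$. Assume: (1) for every edge labeled $k$ with polynomial $P$, $P$ does not depend on $x_k$ and is not divisible by any $x_i$, $i\in[n]$; (2) whenever $t\overset{i}{-}t'\overset{j}{\to}t''$ with $t\neq t''$, where $t'\to t''$ is an oriented spine edge labeled $j$ with polynomial $Q$ and $t\overset{i}{-}t'$ is an edge with polynomial $P$, the polynomials $P$ and $Q_0=Q|_{x_i=0}$ are coprime in $\mathcal{A}[x_1,\dots,x_n]$; (3) whenever $t\overset{i}{-}t'\overset{j}{\to}t''\overset{i}{-}t'''$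 is a path of three distinct edges labeled $i,j,i$, with $t'\to t''$ an oriented spine edge, and with exchange polynomials $P,Q,R$ respectively, we have \[ L\cdot Q_0^{\,b}\cdot P=R\big|_{x_j\leftarrow Q_0/x_j}, \] where $b$ is a nonnegative integer, $Q_0=Q|_{x_i=0}$, and $L$ is a Laurent monomial in $x_1,\dots,x_n$ whose coefficient lies in $\mathcal{A}$ and is coprime with $P$. Then every $x_i(t)$, $i\in[n]$, $t$ a vertex of $\mathbb{T}_{n,m}$, is a Laurent polynomial in $x_1(t_0),\dots,x_n(t_0)$ with coefficients in $\mathcal{A}$.
   Context: For a rational function $F$, $F|_{x\leftarrow g}$ denotes the result of substituting $g$ for $x$ in $F$. The tree $\mathbb{T}_{n,m}$ has $m$ spine vertices of degree $n$ and $m(n-2)+2$ leaves. The exchange rules are consistent because the polynomial on an edge labeled $k$ does not involve $x_k$; the clusters are computed recursively moving away from $t_0$. *)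

theory Defs
  imports "HOL-Library.Poly_Mapping" "HOL-Library.Cardinality" "HOL-Computational_Algebra.Polynomial_Factorial"
begin

text \<open>
  The finite type \<open>'n\<close> plays the role of \<open>[n]\<close>, so that the type
  \<open>('n, 'a) mpoly\<close> is exactly $A[x_1,\dots,x_n]$ and \<open>('n, 'a) ratfun\<close> is its
  field of fractions. A polynomial maps exponent vectors to coefficients. The class
  \<open>linorder\<close> for \<open>'n\<close> is used only because the library's instance of
  \<open>idom\<close> for this type asks for it.
\<close>

type_synonym ('n, 'a) mpoly = "('n \<Rightarrow>\<^sub>0 nat) \<Rightarrow>\<^sub>0 'a"

type_synonym ('n, 'a) ratfun = "('n, 'a) mpoly fract"

definition mconst :: "'a::zero \<Rightarrow> ('n, 'a) mpoly" where
  "mconst c = Poly_Mapping.single 0 c"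

definition mvar :: "'n \<Rightarrow> ('n, 'a::zero_neq_one) mpoly" where
  "mvar i = Poly_Mapping.single (Poly_Mapping.single i 1) 1"

definition rconst :: "'a::idom \<Rightarrow> ('n::linorder, 'a) ratfun" where
  "rconst c = to_fract (mconst c)"

definition rvar :: "'n::linorder \<Rightarrow> ('n, 'a::idom) ratfun" where
  "rvar i = to_fract (mvar i)"

definition depends_on :: "('n, 'a::zero) mpoly \<Rightarrow> 'n \<Rightarrow> bool" where
  "depends_on P i \<longleftrightarrow> (\<exists>e \<in> Poly_Mapping.keys P. Poly_Mapping.lookup e i \<noteq> 0)"

text \<open>Evaluation at the point \<open>g\<close>, the coefficients being mapped by \<open>h\<close>.\<close>

definition mpoly_eval ::
  "('a::zero \<Rightarrow> 'b::comm_semiring_1) \<Rightarrow> ('n::finite \<Rightarrow> 'b) \<Rightarrow> ('n, 'a) mpoly \<Rightarrow> 'b" where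
  "mpoly_eval h g P =
    (\<Sum>e \<in> Poly_Mapping.keys P.
       h (Poly_Mapping.lookup P e) * (\<Prod>i\<in>UNIV. g i ^ Poly_Mapping.lookup e i))"

text \<open>The polynomial $P|_{x_i=0}$.\<close>

definition set_zero :: "'n::finite \<Rightarrow> ('n, 'a::comm_semiring_1) mpoly \<Rightarrow> ('n, 'a) mpoly" where
  "set_zero i P = mpoly_eval mconst (mvar(i := 0)) P"

text \<open>The rational function $P|_{x_j\leftarrow g}$.\<close>

definition subst_var ::
  "'n::{finite,linorder} \<Rightarrow> ('n, 'a::idom) ratfun \<Rightarrow> ('n, 'a) mpoly \<Rightarrow> ('n, 'a) ratfun" where
  "subst_var j g P = mpoly_eval rconst (rvar(j := g)) P"

text \<open>
  The same formula as for the library's \<open>coprime\<close>, which is confined to the class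
  \<open>algebraic_semidom\<close> with its explicit division operation.
\<close>

definition coprime_elems :: "'r::comm_semiring_1 \<Rightarrow> 'r \<Rightarrow> bool" where
  "coprime_elems p q \<longleftrightarrow> (\<forall>d. d dvd p \<longrightarrow> d dvd q \<longrightarrow> d dvd 1)"

definition laurent_monomial ::
  "'a::idom \<Rightarrow> ('n \<Rightarrow> int) \<Rightarrow> ('n::{finite,linorder} \<Rightarrow> ('n, 'a) ratfun) \<Rightarrow> ('n, 'a) ratfun" where
  "laurent_monomial c \<alpha> y = rconst c * (\<Prod>i\<in>UNIV. y i powi \<alpha> i)"

text \<open>
  \<open>f\<close> is a Laurent polynomial in the elements \<open>y i\<close> with coefficients in
  the ground ring.
\<close>

definition laurent_polynomial_in ::
  "('n::{finite,linorder} \<Rightarrow> ('n, 'a::idom) ratfun) \<Rightarrow> ('n, 'a) ratfun \<Rightarrow> bool" where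
  "laurent_polynomial_in y f \<longleftrightarrow>
    (\<exists>S c. finite S \<and> f = (\<Sum>\<alpha>\<in>S. laurent_monomial (c \<alpha>) \<alpha> y))"

text \<open>
  The tree $T_{n,m}$: \<open>Spine 1, \<dots>, Spine m\<close> are $v_1,\dots,v_m$, \<open>Tail\<close> is
  $t_0$, \<open>Head\<close> is $t_{\rm head}$, and \<open>Leaf s k\<close> with \<open>k < n - 2\<close> are
  the further leaves attached to $v_s$. Edges are unordered pairs of vertices.
\<close>

datatype vertex = Tail | Head | Spine nat | Leaf nat nat

definition tree_vertices :: "nat \<Rightarrow> nat \<Rightarrow> vertex set" where
  "tree_vertices n m =
     {Tail, Head} \<union> Spine ` {1..m} \<union> {Leaf s k | s k. s \<in> {1..m} \<and> k < n - 2}"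

definition spine_arc :: "nat \<Rightarrow> vertex \<Rightarrow> vertex \<Rightarrow> bool" where
  "spine_arc m t t' \<longleftrightarrow> (\<exists>s. 1 \<le> s \<and> s < m \<and> t = Spine s \<and> t' = Spine (Suc s))"

definition tree_edges :: "nat \<Rightarrow> nat \<Rightarrow> vertex set set" where
  "tree_edges n m =
     {{Tail, Spine 1}, {Spine m, Head}}
     \<union> {{t, t'} | t t'. spine_arc m t t'}
     \<union> {{Spine s, Leaf s k} | s k. s \<in> {1..m} \<and> k < n - 2}"

lemma degree_spine:
  assumes "n \<ge> 2" "s \<in> {1..m}"
  shows "card {e \<in> tree_edges n m. Spine s \<in> e} = n"
proof -
  let ?a = "if s = 1 then Tail else Spine (s - 1)"
  let ?b = "if s = m then Head else Spine (Suc s)"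
  let ?N = "{?a, ?b} \<union> Leaf s ` {..<n - 2}"
  have "{e \<in> tree_edges n m. Spine s \<in> e} = (\<lambda>u. {Spine s, u}) ` ?N" (is "?L = ?R")
  proof
    show "?L \<subseteq> ?R"
      by (auto simp: tree_edges_def spine_arc_def insert_commute doubleton_eq_iff image_iff)
    have "{Spine s, ?a} \<in> tree_edges n m"
    proof (cases "s = 1")
      case False
      then have "spine_arc m (Spine (s - 1)) (Spine s)"
        using assms by (auto simp: spine_arc_def intro!: exI[of _ "s - 1"])
      then have "{Spine (s - 1), Spine s} \<in> tree_edges n m"
        unfolding tree_edges_def by blast
      then show ?thesis using False by (simp add: insert_commute)
    qed (simp add: tree_edges_def insert_commute)
    moreover have "{Spine s, ?b} \<in> tree_edges n m"
    proof (cases "s = m")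
      case False
      then have "spine_arc m (Spine s) (Spine (Suc s))"
        using assms by (auto simp: spine_arc_def)
      then show ?thesis using False unfolding tree_edges_def by auto
    qed (simp add: tree_edges_def)
    moreover have "{Spine s, Leaf s k} \<in> tree_edges n m" if "k < n - 2" for k
      using that assms unfolding tree_edges_def by blast
    ultimately show "?R \<subseteq> ?L" by auto
  qed
  moreover have "inj_on (\<lambda>u. {Spine s, u}) ?N"
    by (auto simp: inj_on_def doubleton_eq_iff)
  moreover have "card ?N = n"
  proof -
    have "card {?a, ?b} = 2" by auto
    moreover have "card (Leaf s ` {..<n - 2}) = n - 2"
      by (subst card_image) (auto simp: inj_on_def)
    moreover have "{?a, ?b} \<inter> Leaf s ` {..<n - 2} = {}" by auto
    ultimately show ?thesis
      using assms card_Un_disjoint[of "{?a, ?b}" "Leaf s ` {..<n - 2}"] by simp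
  qed
  ultimately show ?thesis by (simp only: card_image)
qed

end

(* Idea: let t -i- t1 -j-> t2 -i- t3 start a path towards the target vertex, with x_i(t1) = z,
   x_j(t2) = u and x_i(t3) = v. By induction on the length of the spine, an element X of the target
   cluster is a Laurent polynomial in the clusters of t1 and of t3, so that X * z^a and X * (u * v)^d
   are Laurent polynomials in x(t). Conditions (2) and (3) make z, u and v Laurent polynomials in x(t)
   with z coprime to u * v; unique factorization then removes z^a. *)

theory Submission
  imports Defs
begin

section \<open>Gauss's lemma for subrings\<close>

text \<open>Condition (3) is what removes the denominator z of v: to lowest order in z the numerator
  of v is B * P with B = L * Q_0^b, and P = z * x_i. Modulo z the quotient is A + B * x_i with A and
  B free of x_i. Since z is P up to the unit x_i, and P is free of x_i as well, coprimality of P to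
  B alone yields coprimality of z to v. This computation is made only once, for x(t) equal to the
  variables themselves. Every other cluster that occurs is algebraically independent, so
  substituting it for the variables is a field endomorphism that carries the result over. The rings
  involved are subsets of fixed types: polynomials in some of the variables, and Laurent polynomials
  inside the field of fractions. Divisibility and primality are therefore taken relative to a
  subring given as a set, and unique factorization in A[x_1, ..., x_n] is obtained by adjoining one
  variable at a time.\<close>

locale subring_of =
  fixes S :: "'b::idom set"
  assumes zero_closed [simp]: "0 \<in> S"
    and one_closed [simp]: "1 \<in> S"
    and diff_closed [simp]: "a \<in> S \<Longrightarrow> b \<in> S \<Longrightarrow> a - b \<in> S"
    and mult_closed [simp]: "a \<in> S \<Longrightarrow> b \<in> S \<Longrightarrow> a * b \<in> S"
begin

lemma uminus_closed [simp]: "a \<in> S \<Longrightarrow> - a \<in> S"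
  using diff_closed[of 0 a] by simp

lemma add_closed [simp]: "a \<in> S \<Longrightarrow> b \<in> S \<Longrightarrow> a + b \<in> S"
  using diff_closed[of a "- b"] by simp

lemma power_closed [simp]: "a \<in> S \<Longrightarrow> a ^ n \<in> S"
  by (induction n) auto

lemma sum_closed: "(\<And>k. k \<in> A \<Longrightarrow> f k \<in> S) \<Longrightarrow> sum f A \<in> S"
  by (induction A rule: infinite_finite_induct) auto

lemma prod_closed: "(\<And>k. k \<in> A \<Longrightarrow> f k \<in> S) \<Longrightarrow> prod f A \<in> S"
  by (induction A rule: infinite_finite_induct) auto

lemma poly_closed: "(\<And>k. coeff p k \<in> S) \<Longrightarrow> a \<in> S \<Longrightarrow> poly p a \<in> S"
  unfolding poly_altdef by (intro sum_closed mult_closed power_closed)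

end

section \<open>Divisibility and prime factorization relative to a subring\<close>

definition polys_over :: "'b::idom set \<Rightarrow> 'b poly set" where
  "polys_over S = {p. \<forall>k. coeff p k \<in> S}"

text \<open>The cofactor has to lie in \<open>S\<close>: inside a field of fractions, divisibility
  in the ambient ring would carry no information.\<close>

definition rel_dvd :: "'b::idom set \<Rightarrow> 'b \<Rightarrow> 'b \<Rightarrow> bool" where
  "rel_dvd S a b \<longleftrightarrow> (\<exists>c\<in>S. b = a * c)"

definition rel_prime :: "'b::idom set \<Rightarrow> 'b \<Rightarrow> bool" where
  "rel_prime S p \<longleftrightarrow> p \<in> S \<and> p \<noteq> 0 \<and> \<not> rel_dvd S p 1 \<and>
     (\<forall>a\<in>S. \<forall>b\<in>S. rel_dvd S p (a * b) \<longrightarrow> rel_dvd S p a \<or> rel_dvd S p b)"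

text \<open>The index counts the prime factors and serves as the induction measure in
  \<open>content_exists_aux\<close>.\<close>

inductive prime_product :: "'b::idom set \<Rightarrow> nat \<Rightarrow> 'b \<Rightarrow> bool" for S where
  unit: "u \<in> S \<Longrightarrow> rel_dvd S u 1 \<Longrightarrow> prime_product S 0 u"
| prime_mult: "rel_prime S p \<Longrightarrow> prime_product S n a \<Longrightarrow> prime_product S (Suc n) (p * a)"

text \<open>The factors are prime and not merely irreducible, so existence of a factorization
  already entails its uniqueness.\<close>

definition factorial_subring :: "'b::idom set \<Rightarrow> bool" where
  "factorial_subring S \<longleftrightarrow> (\<forall>a\<in>S. a \<noteq> 0 \<longrightarrow> (\<exists>n. prime_product S n a))"

lemma rel_prime_in: "rel_prime S p \<Longrightarrow> p \<in> S" and rel_prime_nonzero: "rel_prime S p \<Longrightarrow> p \<noteq> 0"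
  by (auto simp: rel_prime_def)

lemma rel_dvdI: "c \<in> S \<Longrightarrow> rel_dvd S a (a * c)"
  by (auto simp: rel_dvd_def)

lemma rel_dvdE:
  assumes "rel_dvd S a b"
  obtains c where "c \<in> S" "b = a * c"
  using assms by (auto simp: rel_dvd_def)

context subring_of
begin

lemma prime_product_closed: "prime_product S n a \<Longrightarrow> a \<in> S \<and> a \<noteq> 0"
proof (induction rule: prime_product.induct)
  case (unit u)
  then show ?case by (auto elim: rel_dvdE)
next
  case (prime_mult p n a)
  then show ?case using rel_prime_in rel_prime_nonzero by auto
qed

lemma rel_dvd_refl: "rel_dvd S a a"
  using rel_dvdI[OF one_closed, of a] by simp

lemma rel_dvd_trans: "rel_dvd S a b \<Longrightarrow> rel_dvd S b c \<Longrightarrow> rel_dvd S a c"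
  by (elim rel_dvdE) (simp add: mult.assoc rel_dvdI)

lemma rel_dvd_mult: "rel_dvd S a b \<Longrightarrow> c \<in> S \<Longrightarrow> rel_dvd S a (b * c)"
  by (elim rel_dvdE) (simp add: mult.assoc rel_dvdI)

lemma rel_dvd_mult2: "rel_dvd S a b \<Longrightarrow> c \<in> S \<Longrightarrow> rel_dvd S a (c * b)"
  using rel_dvd_mult by (simp add: mult.commute)

lemma rel_dvd_diff: "rel_dvd S a b \<Longrightarrow> rel_dvd S a c \<Longrightarrow> rel_dvd S a (b - c)"
  by (elim rel_dvdE) (simp add: right_diff_distrib[symmetric] rel_dvdI)

lemma rel_dvd_add: "rel_dvd S a b \<Longrightarrow> rel_dvd S a c \<Longrightarrow> rel_dvd S a (b + c)"
  by (elim rel_dvdE) (simp add: distrib_left[symmetric] rel_dvdI)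

lemma rel_dvd_0: "rel_dvd S a 0"
  using rel_dvdI[OF zero_closed, of a] by simp

lemma rel_dvd_sum: "(\<And>k. k \<in> A \<Longrightarrow> rel_dvd S a (f k)) \<Longrightarrow> rel_dvd S a (sum f A)"
  by (induction A rule: infinite_finite_induct) (auto intro: rel_dvd_add rel_dvd_0)

lemma prime_product_unit_mult:
  assumes "prime_product S n a" "u \<in> S" "rel_dvd S u 1"
  shows "prime_product S n (u * a)"
  using assms
proof (induction rule: prime_product.induct)
  case (unit v)
  then obtain u' v' where uv: "u' \<in> S" "v' \<in> S" "1 = u * u'" "1 = v * v'"
    unfolding rel_dvd_def by blast
  have "1 = (u * u') * (v * v')" using uv(3,4) by (metis mult_1)
  also have "\<dots> = (u * v) * (u' * v')" by (simp add: algebra_simps)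
  finally have "rel_dvd S (u * v) 1"
    unfolding rel_dvd_def using uv mult_closed by blast
  then show ?case using unit by (intro prime_product.unit) simp_all
next
  case (prime_mult p n a)
  then show ?case
    by (metis mult.left_commute prime_product.prime_mult)
qed

lemma prime_product_mult:
  assumes "prime_product S n a" "prime_product S k b"
  shows "prime_product S (n + k) (a * b)"
  using assms
proof (induction rule: prime_product.induct)
  case (unit u)
  then show ?case using prime_product_unit_mult by simp
next
  case (prime_mult p n a)
  then show ?case using prime_product.prime_mult[of S p "n + k" "a * b"] by (simp add: mult.assoc)
qed

text \<open>Being prime, \<open>p\<close> divides one of the prime factors; that factor is then
  \<open>p\<close> times a unit, and the unit is absorbed into the remaining product.\<close>

lemma prime_product_prime_dvd:
  assumes "prime_product S n a" "rel_prime S p" "rel_dvd S p a"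
  shows "\<exists>k b. n = Suc k \<and> a = p * b \<and> prime_product S k b"
  using assms
proof (induction rule: prime_product.induct)
  case (unit u)
  then show ?case using rel_dvd_trans unfolding rel_prime_def by blast
next
  case (prime_mult q n a)
  have pq: "p \<in> S" "q \<in> S" "a \<in> S" "q \<noteq> 0" "p \<noteq> 0"
    using prime_mult prime_product_closed by (auto simp: rel_prime_def)
  have "rel_dvd S p q \<or> rel_dvd S p a"
    using prime_mult pq by (auto simp: rel_prime_def)
  then show ?case
  proof
    assume "rel_dvd S p q"
    then obtain e where e: "e \<in> S" "q = p * e" by (auto simp: rel_dvd_def)
    \<comment> \<open>Primality of \<open>q\<close> is applied to \<open>q = p * e\<close>; the
      alternative that \<open>q\<close> divides \<open>e\<close> would make \<open>p\<close> a
      unit.\<close>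
    have "\<not> rel_dvd S q p \<Longrightarrow> rel_dvd S q e"
      using prime_mult.hyps e pq rel_dvd_refl unfolding rel_prime_def by blast
    moreover have "\<not> rel_dvd S q e"
    proof
      assume "rel_dvd S q e"
      then obtain d where d: "d \<in> S" "e = q * d" by (auto simp: rel_dvd_def)
      then have "e = e * (p * d)" using e by (simp add: algebra_simps)
      then have "1 = p * d" using e pq by auto
      then have "rel_dvd S p 1" using d(1) unfolding rel_dvd_def by blast
      then show False using prime_mult.prems by (simp add: rel_prime_def)
    qed
    ultimately obtain d where d: "d \<in> S" "p = q * d" by (auto simp: rel_dvd_def)
    then have "p = p * (e * d)" using e by (simp add: mult.assoc)
    then have "1 = e * d" using pq by auto
    then have "rel_dvd S e 1" unfolding rel_dvd_def using d(1) by blast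
    then have "prime_product S n (e * a)"
      using prime_mult.hyps(2) e(1) prime_product_unit_mult by blast
    moreover have "q * a = p * (e * a)" using e(2) by (simp add: mult.assoc)
    ultimately show ?thesis by blast
  next
    assume "rel_dvd S p a"
    then obtain k b where b: "n = Suc k" "a = p * b" "prime_product S k b"
      using prime_mult.IH[OF prime_mult.prems(1)] by blast
    have "q * a = p * (q * b)" using b(2) by (simp add: mult.left_commute)
    then show ?thesis using prime_product.prime_mult[OF prime_mult.hyps(1) b(3)] b(1) by blast
  qed
qed

section \<open>Polynomials over a factorial subring: contents and pseudo-division\<close>

lemma subring_polys_over: "subring_of (polys_over S)"
proof
  show "p * q \<in> polys_over S" if "p \<in> polys_over S" "q \<in> polys_over S" for p q
    using that unfolding polys_over_def by (auto simp: coeff_mult intro!: sum_closed)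
qed (auto simp: polys_over_def coeff_1)

lemma const_in_polys_over: "a \<in> S \<Longrightarrow> [:a:] \<in> polys_over S"
  by (auto simp: polys_over_def coeff_pCons split: nat.splits)

lemma smult_in_polys_over: "a \<in> S \<Longrightarrow> p \<in> polys_over S \<Longrightarrow> smult a p \<in> polys_over S"
  by (auto simp: polys_over_def)

lemma rel_dvd_const_iff:
  assumes "p \<in> polys_over S"
  shows "rel_dvd (polys_over S) [:c:] p \<longleftrightarrow> (\<forall>k. rel_dvd S c (coeff p k))"
proof
  assume "\<forall>k. rel_dvd S c (coeff p k)"
  then have "\<exists>f. \<forall>k. f k \<in> S \<and> coeff p k = c * f k"
    unfolding rel_dvd_def by (intro choice) auto
  then obtain f where f: "\<And>k. f k \<in> S" "\<And>k. coeff p k = c * f k" by blast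
  \<comment> \<open>The list is cut off at the degree of \<open>p\<close>: for \<open>c = 0\<close>
    the chosen quotients need not vanish beyond it.\<close>
  define q where "q = Poly (map f [0..<Suc (degree p)])"
  have q: "coeff q k = (if k \<le> degree p then f k else 0)" for k
    unfolding q_def by (auto simp: nth_default_def nth_append simp del: upt_Suc)
  have "p = [:c:] * q"
    by (rule poly_eqI) (auto simp: q f(2)[symmetric] coeff_eq_0)
  moreover have "q \<in> polys_over S" by (auto simp: polys_over_def q f)
  ultimately show "rel_dvd (polys_over S) [:c:] p" by (auto simp: rel_dvd_def)
qed (auto simp: rel_dvd_def polys_over_def)

text \<open>Gauss's argument: if \<open>a\<close> and \<open>b\<close> are the first indices at
  which \<open>p\<close> and \<open>q\<close> have a coefficient not divisible by \<open>c\<close>,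
  then all but one of the summands of coefficient \<open>a + b\<close> of the product are divisible
  by \<open>c\<close>.\<close>

lemma rel_prime_const:
  assumes "rel_prime S c"
  shows "rel_prime (polys_over S) [:c:]"
  unfolding rel_prime_def
proof (intro conjI ballI impI)
  have c: "c \<in> S" "c \<noteq> 0" "\<not> rel_dvd S c 1"
    "\<And>a b. a \<in> S \<Longrightarrow> b \<in> S \<Longrightarrow> rel_dvd S c (a * b) \<Longrightarrow> rel_dvd S c a \<or> rel_dvd S c b"
    using assms by (auto simp: rel_prime_def)
  show "[:c:] \<in> polys_over S" "[:c:] \<noteq> 0" using c const_in_polys_over by auto
  show "\<not> rel_dvd (polys_over S) [:c:] 1"
    using c subring_of.one_closed[OF subring_polys_over]
    by (auto simp: rel_dvd_const_iff coeff_1 intro!: exI[of _ 0])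
  fix p q
  assume pq: "p \<in> polys_over S" "q \<in> polys_over S" "rel_dvd (polys_over S) [:c:] (p * q)"
  then have cS: "\<And>k. coeff p k \<in> S" "\<And>k. coeff q k \<in> S" by (auto simp: polys_over_def)
  have dvd: "rel_dvd S c (coeff (p * q) k)" for k
    using pq rel_dvd_const_iff subring_of.mult_closed[OF subring_polys_over] by blast
  show "rel_dvd (polys_over S) [:c:] p \<or> rel_dvd (polys_over S) [:c:] q"
  proof (rule ccontr)
    assume "\<not> ?thesis"
    then have ex: "\<exists>k. \<not> rel_dvd S c (coeff p k)" "\<exists>k. \<not> rel_dvd S c (coeff q k)"
      using pq rel_dvd_const_iff by auto
    define a where "a = (LEAST k. \<not> rel_dvd S c (coeff p k))"
    define b where "b = (LEAST k. \<not> rel_dvd S c (coeff q k))"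
    have a: "\<not> rel_dvd S c (coeff p a)" "\<And>k. k < a \<Longrightarrow> rel_dvd S c (coeff p k)"
      unfolding a_def using LeastI_ex[OF ex(1)] by (auto dest: not_less_Least)
    have b: "\<not> rel_dvd S c (coeff q b)" "\<And>k. k < b \<Longrightarrow> rel_dvd S c (coeff q k)"
      unfolding b_def using LeastI_ex[OF ex(2)] by (auto dest: not_less_Least)
    define s where "s = (\<Sum>k\<in>{..a + b} - {a}. coeff p k * coeff q (a + b - k))"
    have "coeff (p * q) (a + b) =
        coeff p a * coeff q b + (\<Sum>k\<in>{..a + b} - {a}. coeff p k * coeff q (a + b - k))"
      unfolding coeff_mult by (subst sum.remove[of _ a]) auto
    then have eq: "coeff p a * coeff q b = coeff (p * q) (a + b) - s" by (simp add: s_def)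
    have "rel_dvd S c s" unfolding s_def
    proof (rule rel_dvd_sum)
      fix k assume k: "k \<in> {..a + b} - {a}"
      show "rel_dvd S c (coeff p k * coeff q (a + b - k))"
      proof (cases "k < a")
        case True
        then show ?thesis using a cS rel_dvd_mult by blast
      next
        case False
        then have "a + b - k < b" using k by auto
        then show ?thesis using b cS rel_dvd_mult2 by blast
      qed
    qed
    then have "rel_dvd S c (coeff p a * coeff q b)"
      unfolding eq by (rule rel_dvd_diff[OF dvd])
    then show False using c a b cS by blast
  qed
qed

lemma prime_product_const:
  assumes "prime_product S n c"
  shows "prime_product (polys_over S) n [:c:]"
  using assms
proof (induction rule: prime_product.induct)
  case (unit u)
  then obtain v where "v \<in> S" "1 = u * v" by (auto simp: rel_dvd_def)
  then have "1 = [:u:] * [:v:]" by (simp add: one_pCons mult.commute)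
  then have "rel_dvd (polys_over S) [:u:] 1"
    unfolding rel_dvd_def using \<open>v \<in> S\<close> const_in_polys_over by blast
  then show ?case using unit const_in_polys_over by (intro prime_product.unit) blast+
next
  case (prime_mult p n a)
  have "[:p * a:] = [:p:] * [:a:]" by simp
  show ?case unfolding \<open>[:p * a:] = [:p:] * [:a:]\<close>
    by (rule prime_product.prime_mult[OF rel_prime_const[OF prime_mult.hyps(1)] prime_mult.IH])
qed

text \<open>Expressed through prime constants, so that no gcd of the coefficients has to be
  formed.\<close>

definition primitive :: "'b poly \<Rightarrow> bool" where
  "primitive p \<longleftrightarrow> p \<in> polys_over S \<and> p \<noteq> 0 \<and>
     (\<forall>c. rel_prime S c \<longrightarrow> \<not> rel_dvd (polys_over S) [:c:] p)"

text \<open>Dividing \<open>p\<close> by a prime constant removes one prime factor from its leading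
  coefficient, so the extraction of constants terminates.\<close>

lemma content_exists_aux:
  assumes "prime_product S n (lead_coeff p)" "p \<in> polys_over S" "p \<noteq> 0"
  shows "\<exists>c q. c \<in> S \<and> c \<noteq> 0 \<and> p = [:c:] * q \<and> primitive q"
  using assms
proof (induction n arbitrary: p rule: less_induct)
  case (less n)
  show ?case
  proof (cases "primitive p")
    case True
    then show ?thesis by (intro exI[of _ 1] exI[of _ p]) auto
  next
    case False
    then obtain c where c: "rel_prime S c" "rel_dvd (polys_over S) [:c:] p"
      using less by (auto simp: primitive_def)
    then obtain q where q: "q \<in> polys_over S" "p = [:c:] * q" by (auto simp: rel_dvd_def)
    then have lc: "lead_coeff p = c * lead_coeff q"
      by (metis lead_coeff_mult lead_coeff_pCons(2))
    have "q \<noteq> 0" using q less by auto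
    have "rel_dvd S c (lead_coeff p)" using c less rel_dvd_const_iff by auto
    then obtain k b where "n = Suc k" "lead_coeff p = c * b" "prime_product S k b"
      using less c prime_product_prime_dvd by blast
    moreover from this have "b = lead_coeff q" using lc c by (auto simp: rel_prime_def)
    ultimately obtain d r where d: "d \<in> S" "d \<noteq> 0" "q = [:d:] * r" "primitive r"
      using less.IH[of k q] q \<open>q \<noteq> 0\<close> by auto
    moreover have "p = [:c * d:] * r" using q(2) d(3) by (simp add: mult.commute)
    moreover have "c * d \<in> S" "c * d \<noteq> 0"
      using d(1,2) rel_prime_in[OF c(1)] rel_prime_nonzero[OF c(1)] by simp_all
    ultimately show ?thesis by blast
  qed
qed

lemma content_exists:
  assumes "factorial_subring S" "p \<in> polys_over S" "p \<noteq> 0"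
  shows "\<exists>c q. c \<in> S \<and> c \<noteq> 0 \<and> p = [:c:] * q \<and> primitive q"
proof -
  have "lead_coeff p \<in> S" "lead_coeff p \<noteq> 0" using assms by (auto simp: polys_over_def)
  then obtain n where "prime_product S n (lead_coeff p)"
    using assms unfolding factorial_subring_def by blast
  then show ?thesis using content_exists_aux assms by blast
qed

text \<open>Each prime factor of \<open>c\<close> divides \<open>g * h\<close> but not the primitive
  \<open>g\<close>; hence it divides \<open>h\<close> and can be cancelled.\<close>

lemma primitive_cancel_const:
  assumes "prime_product S n c" "primitive g" "h \<in> polys_over S" "f \<in> polys_over S"
    "g * h = [:c:] * f"
  shows "rel_dvd (polys_over S) g f"
  using assms
proof (induction arbitrary: h rule: prime_product.induct)
  case (unit u)
  then obtain v where v: "v \<in> S" "1 = u * v" by (auto simp: rel_dvd_def)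
  have "f = ([:u:] * [:v:]) * f" using v by (simp add: one_pCons[symmetric] mult.commute)
  also have "\<dots> = [:v:] * (g * h)" using unit by (simp only: ac_simps)
  finally show ?case using v unit const_in_polys_over subring_of.mult_closed[OF subring_polys_over]
    unfolding rel_dvd_def by (intro bexI[of _ "[:v:] * h"]) (simp_all add: ac_simps smult_in_polys_over)
next
  case (prime_mult p n a)
  have aS: "a \<in> S" using prime_mult prime_product_closed by auto
  have eq: "g * h = [:p:] * ([:a:] * f)" using prime_mult by (simp add: mult.commute)
  then have "rel_dvd (polys_over S) [:p:] (g * h)"
    using aS prime_mult const_in_polys_over subring_of.mult_closed[OF subring_polys_over]
    unfolding rel_dvd_def by blast
  then have "rel_dvd (polys_over S) [:p:] h"
    using rel_prime_const[OF prime_mult.hyps(1)] prime_mult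
    unfolding rel_prime_def primitive_def by blast
  then obtain h' where h': "h' \<in> polys_over S" "h = [:p:] * h'" by (auto simp: rel_dvd_def)
  then have "[:p:] * (g * h') = [:p:] * ([:a:] * f)" using eq by (simp only: ac_simps)
  then have "g * h' = [:a:] * f" using rel_prime_nonzero[OF prime_mult.hyps(1)]
    by (metis mult_cancel_left pCons_eq_0_iff)
  then show ?case using prime_mult.IH[OF prime_mult.prems(1) h'(1) prime_mult.prems(3)] by blast
qed

text \<open>Division with remainder without inverses: multiplying by the leading coefficient of
  \<open>d\<close> before each subtraction makes the leading terms cancel, at the price of the
  constant \<open>c\<close>.\<close>

lemma pseudo_division:
  assumes "d \<in> polys_over S" "d \<noteq> 0" "p \<in> polys_over S"
  shows "\<exists>c q r. c \<in> S \<and> c \<noteq> 0 \<and> q \<in> polys_over S \<and> r \<in> polys_over S \<and>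
    [:c:] * p = q * d + r \<and> (r = 0 \<or> degree r < degree d)"
  using assms(3)
proof (induction "degree p" arbitrary: p rule: less_induct)
  case less
  interpret P: subring_of "polys_over S" by (rule subring_polys_over)
  show ?case
  proof (cases "p = 0 \<or> degree p < degree d")
    case True
    then show ?thesis using less by (intro exI[of _ 1] exI[of _ 0] exI[of _ p]) auto
  next
    case False
    define a where "a = lead_coeff d"
    define w where "w = monom (lead_coeff p) (degree p - degree d)"
    define p' where "p' = [:a:] * p - w * d"
    have aS: "a \<in> S" "a \<noteq> 0" using assms by (auto simp: a_def polys_over_def)
    have w: "w \<in> polys_over S" using less by (auto simp: w_def polys_over_def coeff_monom)
    have p': "p' \<in> polys_over S" unfolding p'_def using aS w assms less by (simp add: smult_in_polys_over)
    have le: "degree d \<le> degree p" using False by auto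
    have lcw: "lead_coeff w = lead_coeff p" "degree w = degree p - degree d"
      using False by (auto simp: w_def degree_monom_eq)
    have "w \<noteq> 0" using False by (auto simp: w_def)
    have dw: "degree (w * d) = degree p"
      using \<open>w \<noteq> 0\<close> assms lcw le by (subst degree_mult_eq) auto
    have "coeff (w * d) (degree p) = lead_coeff p * a"
      using dw lead_coeff_mult[of w d] lcw by (metis a_def)
    then have c0: "coeff p' (degree p) = 0" by (simp add: p'_def mult.commute)
    have "degree p' \<le> degree p" unfolding p'_def
      using dw aS by (intro degree_diff_le) auto
    show ?thesis
    proof (cases "degree p' < degree p")
      case True
      then obtain c q r where r: "c \<in> S" "c \<noteq> 0" "q \<in> polys_over S" "r \<in> polys_over S"
        "[:c:] * p' = q * d + r" "r = 0 \<or> degree r < degree d"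
        using less.hyps[OF True p'] by blast
      have "[:c * a:] * p = [:c:] * ([:a:] * p)" by (simp add: mult.commute)
      also have "\<dots> = [:c:] * p' + [:c:] * w * d" by (simp add: p'_def algebra_simps)
      also have "\<dots> = (q + [:c:] * w) * d + r" unfolding r by (simp only: algebra_simps)
      finally show ?thesis
        using r(1-4,6) aS w const_in_polys_over[of c]
        by (metis P.add_closed P.mult_closed mult_closed mult_eq_0_iff)
    next
      case False
      \<comment> \<open>The degree fails to drop only if \<open>p'\<close> is zero, in which case
        \<open>p\<close> is constant.\<close>
      then have "degree p' = degree p" using \<open>degree p' \<le> degree p\<close> by simp
      then have "p' = 0" using c0 by (metis leading_coeff_0_iff)
      then have "[:a:] * p = w * d + 0" by (simp add: p'_def)
      then show ?thesis using aS w P.zero_closed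
        by (metis less_irrefl)
    qed
  qed
qed

text \<open>A prime factor of \<open>e\<close> would be a prime constant dividing \<open>p\<close>,
  so the factorization of \<open>e\<close> consists of its unit alone.\<close>

lemma primitive_const_factor:
  assumes "factorial_subring S" "primitive p" "p = f * [:e:]" "f \<in> polys_over S" "e \<in> S"
  shows "rel_dvd S e 1"
proof -
  have "e \<noteq> 0" using assms by (auto simp: primitive_def)
  then obtain n where "prime_product S n e" using assms by (auto simp: factorial_subring_def)
  then show ?thesis
  proof cases
    case (prime_mult q n a)
    then have "p = [:q:] * (f * [:a:])" using assms by (simp add: ac_simps)
    moreover have "f * [:a:] \<in> polys_over S" using assms prime_mult prime_product_closed
        const_in_polys_over subring_of.mult_closed[OF subring_polys_over] by blast
    ultimately show ?thesis using assms prime_mult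
      unfolding primitive_def rel_dvd_def by blast
  qed
qed

text \<open>
  Euclid's lemma over the fraction field, with denominators cleared: a nonzero element of least
  degree in the ideal of \<open>p\<close> and \<open>f\<close> divides both up to a constant.
\<close>

lemma primitive_irreducible_prime:
  assumes ufd: "factorial_subring S" and p: "primitive p" "degree p > 0"
    and irr: "\<And>f g. f \<in> polys_over S \<Longrightarrow> g \<in> polys_over S \<Longrightarrow> p = f * g \<Longrightarrow>
      degree f = 0 \<or> degree g = 0"
  shows "rel_prime (polys_over S) p"
  unfolding rel_prime_def
proof (intro conjI ballI impI)
  interpret P: subring_of "polys_over S" by (rule subring_polys_over)
  show pS: "p \<in> polys_over S" and p0: "p \<noteq> 0" using p by (auto simp: primitive_def)
  show "\<not> rel_dvd (polys_over S) p 1"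
  proof
    assume "rel_dvd (polys_over S) p 1"
    then obtain q where "1 = p * q" by (auto simp: rel_dvd_def)
    moreover from this have "q \<noteq> 0" by auto
    ultimately have "degree (1 :: 'b poly) = degree p + degree q"
      using p0 degree_mult_eq[of p q] by simp
    then show False using p by simp
  qed
  have cancel: "rel_dvd (polys_over S) g h"
    if "c \<in> S" "c \<noteq> 0" "primitive g" "k \<in> polys_over S" "h \<in> polys_over S" "g * k = [:c:] * h"
    for c g k h
    using that ufd primitive_cancel_const unfolding factorial_subring_def by blast
  fix f g
  assume f: "f \<in> polys_over S" and g: "g \<in> polys_over S"
    and dvd: "rel_dvd (polys_over S) p (f * g)"
  define I where "I = {d. d \<noteq> 0 \<and> (\<exists>a\<in>polys_over S. \<exists>b\<in>polys_over S. d = a * p + b * f)}"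
  have "p = 1 * p + 0 * f" by simp
  then have "p \<in> I" unfolding I_def using p0 P.one_closed P.zero_closed by blast
  then obtain d where d: "d \<in> I" "\<And>e. e \<in> I \<Longrightarrow> degree d \<le> degree e"
    using ex_has_least_nat[of "\<lambda>d. d \<in> I" p degree] by blast
  then obtain a b where ab: "a \<in> polys_over S" "b \<in> polys_over S" "d = a * p + b * f" and d0: "d \<noteq> 0"
    by (auto simp: I_def)
  have dS: "d \<in> polys_over S" using ab f pS by auto
  obtain c d' where d': "c \<in> S" "c \<noteq> 0" "d = [:c:] * d'" "primitive d'"
    using content_exists[OF ufd dS d0] by blast
  have d'S: "d' \<in> polys_over S" "d' \<noteq> 0" using d' by (auto simp: primitive_def)
  \<comment> \<open>The pseudo-remainder of \<open>h\<close> lies in the ideal again, so minimality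
    makes it zero; primitivity of \<open>d'\<close> then removes the constant.\<close>
  have dvd': "rel_dvd (polys_over S) d' h"
    if h: "h = u * p + v * f" "u \<in> polys_over S" "v \<in> polys_over S" for h u v
  proof -
    have hS: "h \<in> polys_over S" using h pS f by auto
    obtain e q r where e: "e \<in> S" "e \<noteq> 0" "q \<in> polys_over S" "r \<in> polys_over S"
      "[:e:] * h = q * d + r" "r = 0 \<or> degree r < degree d"
      using pseudo_division[OF dS d0 hS] by blast
    have "r = ([:e:] * u - q * a) * p + ([:e:] * v - q * b) * f"
      using e(5) unfolding h ab by (simp add: algebra_simps)
    moreover have "[:e:] * u - q * a \<in> polys_over S" "[:e:] * v - q * b \<in> polys_over S"
      using e ab h const_in_polys_over by (auto simp del: mult_pCons_left)
    ultimately have "r = 0 \<or> r \<in> I" unfolding I_def by blast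
    then have "r = 0" using d(2) e(6) by fastforce
    then have "d' * ([:c:] * q) = [:e:] * h" using e d' by (simp add: ac_simps)
    then show ?thesis using cancel[OF e(1,2) d'(4) _ hS] d' e const_in_polys_over P.mult_closed
      by blast
  qed
  have "rel_dvd (polys_over S) d' p" by (rule dvd'[of p 1 0]) auto
  then obtain q where q: "q \<in> polys_over S" "p = d' * q" by (auto simp: rel_dvd_def)
  then consider "degree d' = 0" | "degree q = 0" using irr[OF d'S(1) q] by metis
  then show "rel_dvd (polys_over S) p f \<or> rel_dvd (polys_over S) p g"
  proof cases
    case 1
    then obtain k where k: "d' = [:k:]" using degree_eq_zeroE by blast
    then have "coeff d' 0 = k" "k \<noteq> 0" using d'S by auto
    then have kS: "c * k \<in> S" "c * k \<noteq> 0" using d' d'S by (auto simp: polys_over_def)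
    obtain w where w: "w \<in> polys_over S" "f * g = p * w" using dvd by (auto simp: rel_dvd_def)
    \<comment> \<open>Here \<open>d\<close> is the constant \<open>c * k\<close>. Multiplying
      \<open>d = a * p + b * f\<close> by \<open>g\<close> makes a constant multiple of
      \<open>g\<close> divisible by \<open>p\<close>, and primitivity of \<open>p\<close> removes
      the constant.\<close>
    have "[:c * k:] * g = d * g" using d' k by (simp add: mult.commute)
    also have "\<dots> = p * (a * g + b * w)"
      unfolding ab using w by (simp add: algebra_simps)
    finally have eq: "p * (a * g + b * w) = [:c * k:] * g" ..
    have "a * g + b * w \<in> polys_over S" using ab g w by simp
    then show ?thesis using cancel[OF kS p(1) _ g eq] by blast
  next
    case 2
    then obtain e where e: "q = [:e:]" using degree_eq_zeroE by blast
    then have eS: "e \<in> S" using q by (auto simp: polys_over_def dest: spec[of _ 0])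
    \<comment> \<open>Hence \<open>p\<close> and \<open>d'\<close> are associates, and
      \<open>p\<close> divides \<open>f\<close> because \<open>d'\<close> does.\<close>
    then have "rel_dvd S e 1"
      using primitive_const_factor[OF ufd p(1)] q e d'S by blast
    then obtain e' where e': "e' \<in> S" "1 = e * e'" by (auto simp: rel_dvd_def)
    have "rel_dvd (polys_over S) d' f" by (rule dvd'[of f 0 1]) auto
    then obtain w where w: "w \<in> polys_over S" "f = d' * w" by (auto simp: rel_dvd_def)
    have "[:e:] * [:e':] = 1" using e' by (simp add: one_pCons mult.commute)
    then have "f = d' * ([:e:] * [:e':]) * w" using w by simp
    then have "f = p * ([:e':] * w)" using q e by (simp only: ac_simps)
    then have "rel_dvd (polys_over S) p f"
      using w e' const_in_polys_over P.mult_closed unfolding rel_dvd_def by blast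
    then show ?thesis ..
  qed
qed

text \<open>The content factors by hypothesis. The primitive part is either constant, or a product
  of two factors of smaller degree, or irreducible and then prime.\<close>

theorem factorial_polys_over:
  assumes ufd: "factorial_subring S"
  shows "factorial_subring (polys_over S)"
proof -
  interpret P: subring_of "polys_over S" by (rule subring_polys_over)
  have "\<exists>n. prime_product (polys_over S) n p" if "p \<in> polys_over S" "p \<noteq> 0" for p
    using that
  proof (induction "degree p" arbitrary: p rule: less_induct)
    case less
    have const: "\<exists>n. prime_product (polys_over S) n [:c:]" if "c \<in> S" "c \<noteq> 0" for c
      using ufd that prime_product_const unfolding factorial_subring_def by blast
    obtain c q where q: "c \<in> S" "c \<noteq> 0" "p = [:c:] * q" "primitive q"
      using content_exists[OF ufd] less by blast
    have qS: "q \<in> polys_over S" "q \<noteq> 0" using q by (auto simp: primitive_def)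
    have dq: "degree q = degree p" using q by simp
    have "\<exists>n. prime_product (polys_over S) n q"
    proof (cases "degree q = 0")
      case True
      then obtain k where "q = [:k:]" using degree_eq_zeroE by blast
      then show ?thesis using const[of k] qS by (auto simp: polys_over_def dest: spec[of _ 0])
    next
      case False
      show ?thesis
      proof (cases "\<exists>f g. f \<in> polys_over S \<and> g \<in> polys_over S \<and> q = f * g \<and>
          degree f \<noteq> 0 \<and> degree g \<noteq> 0")
        case True
        then obtain f g where fg: "f \<in> polys_over S" "g \<in> polys_over S" "q = f * g"
          "degree f \<noteq> 0" "degree g \<noteq> 0" by blast
        then have "f \<noteq> 0" "g \<noteq> 0" using qS by auto
        then have "degree q = degree f + degree g" using fg degree_mult_eq by blast
        then obtain n k where "prime_product (polys_over S) n f" "prime_product (polys_over S) k g"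
          using less.hyps[of f] less.hyps[of g] fg dq \<open>f \<noteq> 0\<close> \<open>g \<noteq> 0\<close> by auto
        then show ?thesis using P.prime_product_mult fg by blast
      next
        case False
        then have "rel_prime (polys_over S) q"
          using primitive_irreducible_prime[OF ufd q(4)] \<open>degree q \<noteq> 0\<close> by blast
        moreover have "prime_product (polys_over S) 0 1"
          by (rule prime_product.unit) (auto simp: P.rel_dvd_refl)
        ultimately have "prime_product (polys_over S) (Suc 0) (q * 1)" by (rule prime_product.prime_mult)
        then show ?thesis by auto
      qed
    qed
    then show ?case using const[OF q(1,2)] P.prime_product_mult unfolding q(3) by blast
  qed
  then show ?thesis by (auto simp: factorial_subring_def)
qed

end

text \<open>Relative divisibility is a purely multiplicative notion, so an injective map respecting
  products, 0 and 1 carries primes of \<open>S\<close> to primes of the image.\<close>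

lemma prime_product_image:
  fixes \<psi> :: "'b::idom \<Rightarrow> 'c::idom"
  assumes S: "subring_of S" and inj: "inj_on \<psi> S" and one: "\<psi> 1 = 1"
    and mult: "\<And>a b. a \<in> S \<Longrightarrow> b \<in> S \<Longrightarrow> \<psi> (a * b) = \<psi> a * \<psi> b"
    and zero: "\<psi> 0 = 0"
    and a: "prime_product S n a"
  shows "prime_product (\<psi> ` S) n (\<psi> a)"
proof -
  interpret subring_of S by (rule S)
  have dvd: "rel_dvd (\<psi> ` S) (\<psi> a) (\<psi> b) \<longleftrightarrow> rel_dvd S a b" if ab: "a \<in> S" "b \<in> S" for a b
  proof
    assume "rel_dvd (\<psi> ` S) (\<psi> a) (\<psi> b)"
    then obtain c where c: "c \<in> S" "\<psi> b = \<psi> (a * c)" using ab by (auto simp: rel_dvd_def mult)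
    then have "b = a * c" using inj_onD[OF inj c(2)] ab by simp
    then show "rel_dvd S a b" using c by (auto simp: rel_dvd_def)
  qed (use ab mult in \<open>auto simp: rel_dvd_def\<close>)
  have dvd1: "rel_dvd (\<psi> ` S) (\<psi> a) 1 \<longleftrightarrow> rel_dvd S a 1" if "a \<in> S" for a
    using dvd[OF that one_closed] one by simp
  have prime: "rel_prime (\<psi> ` S) (\<psi> p)" if "rel_prime S p" for p
  proof -
    have p: "p \<in> S" "p \<noteq> 0" using that by (auto simp: rel_prime_def)
    have "\<psi> p \<noteq> 0" using p inj zero by (metis inj_on_def zero_closed)
    then show ?thesis
      using that p by (auto simp: rel_prime_def dvd dvd1 mult[symmetric])
  qed
  show ?thesis
    using a
  proof (induction rule: prime_product.induct)
    case (unit u)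
    then show ?case by (intro prime_product.unit) (auto simp: dvd1)
  next
    case (prime_mult p n a)
    then have "\<psi> (p * a) = \<psi> p * \<psi> a"
      using prime_product_closed by (intro mult) (auto simp: rel_prime_def)
    then show ?case using prime_mult prime by (auto intro: prime_product.prime_mult)
  qed
qed

lemma factorial_subring_image:
  fixes \<psi> :: "'b::idom \<Rightarrow> 'c::idom"
  assumes "factorial_subring S" "subring_of S" "inj_on \<psi> S" "\<psi> 1 = 1" "\<psi> 0 = 0"
    "\<And>a b. a \<in> S \<Longrightarrow> b \<in> S \<Longrightarrow> \<psi> (a * b) = \<psi> a * \<psi> b"
  shows "factorial_subring (\<psi> ` S)"
  using assms prime_product_image[of S \<psi>] unfolding factorial_subring_def by fastforce

section \<open>Polynomials in finitely many variables\<close>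

text \<open>A subset of the full polynomial ring rather than a type of its own, so that variables
  can be adjoined one by one.\<close>

definition mpolys :: "'n set \<Rightarrow> ('n, 'a::zero) mpoly set" where
  "mpolys V = {P. \<forall>i. depends_on P i \<longrightarrow> i \<in> V}"

lemma mpolys_iff_keys:
  "P \<in> mpolys V \<longleftrightarrow> (\<forall>e\<in>Poly_Mapping.keys P. Poly_Mapping.keys e \<subseteq> V)"
  unfolding mpolys_def depends_on_def lookup_not_eq_zero_eq_in_keys by blast

lemma mpolys_UNIV [simp]: "P \<in> mpolys UNIV"
  by (simp add: mpolys_def)

lemma mpolys_mono: "V \<subseteq> W \<Longrightarrow> mpolys V \<subseteq> mpolys W"
  by (auto simp: mpolys_def)

lemma not_depends_on_iff: "\<not> depends_on P i \<longleftrightarrow> P \<in> mpolys (- {i})"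
  by (auto simp: mpolys_def)

lemma subring_mpolys:
  "subring_of (mpolys V :: ('n::{finite,linorder}, 'a::idom) mpoly set)"
proof
  fix P Q :: "('n, 'a) mpoly"
  assume PQ: "P \<in> mpolys V" "Q \<in> mpolys V"
  show "P - Q \<in> mpolys V"
    using PQ keys_diff[of P Q] unfolding mpolys_iff_keys by blast
  show "P * Q \<in> mpolys V"
    unfolding mpolys_iff_keys
  proof
    fix e assume "e \<in> Poly_Mapping.keys (P * Q)"
    then obtain d d' where "e = d + d'" "d \<in> Poly_Mapping.keys P" "d' \<in> Poly_Mapping.keys Q"
      using keys_mult[of P Q] by blast
    then show "Poly_Mapping.keys e \<subseteq> V"
      using PQ Poly_Mapping.keys_add[of d d'] unfolding mpolys_iff_keys by blast
  qed
qed (auto simp: mpolys_iff_keys)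

lemma mconst_in_mpolys [simp]: "mconst c \<in> mpolys V"
  by (auto simp: mpolys_iff_keys mconst_def)

lemma mvar_in_mpolys [simp]:
  "i \<in> V \<Longrightarrow> (mvar i :: ('n, 'a::{zero_neq_one}) mpoly) \<in> mpolys V"
  by (auto simp: mpolys_iff_keys mvar_def)

lemma mvar_nonzero [simp]: "mvar i \<noteq> (0 :: ('n, 'a::zero_neq_one) mpoly)"
  by (metis lookup_single_eq lookup_zero mvar_def zero_neq_one)

lemma mconst_0 [simp]: "mconst 0 = 0"
  by (simp add: mconst_def)

lemma mconst_1 [simp]: "mconst 1 = 1"
  by (simp add: mconst_def)

lemma mconst_add: "mconst (a + b) = mconst a + mconst b"
  by (simp add: mconst_def single_add)

lemma mconst_mult: "mconst (a * b) = mconst a * mconst (b :: 'a::comm_semiring_1)"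
  by (simp add: mconst_def mult_single)

lemma mconst_eq_iff [simp]: "mconst a = mconst b \<longleftrightarrow> a = b"
  by (metis lookup_single_eq mconst_def)

lemma mvar_power:
  "(mvar i :: ('n, 'a::comm_semiring_1) mpoly) ^ k = Poly_Mapping.single (Poly_Mapping.single i k) 1"
  by (induction k) (simp_all add: mvar_def mult_single single_add[symmetric])

lemma exponent_sum: "(\<Sum>i\<in>(UNIV::'n::finite set). Poly_Mapping.single i (Poly_Mapping.lookup e i)) = e"
  by (rule poly_mapping_eqI) (simp add: lookup_sum lookup_single when_def)

lemma prod_single:
  "finite A \<Longrightarrow> (\<Prod>i\<in>A. Poly_Mapping.single (f i) (1::'a::comm_semiring_1)) =
    Poly_Mapping.single (\<Sum>i\<in>A. f i) 1"
  by (induction A rule: finite_induct) (simp_all add: mult_single)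

lemma single_eq_monomial:
  "(Poly_Mapping.single e c :: ('n::finite, 'a::comm_semiring_1) mpoly) =
    mconst c * (\<Prod>i\<in>UNIV. mvar i ^ Poly_Mapping.lookup e i)"
  by (simp add: mvar_power prod_single exponent_sum mconst_def mult_single)

lemma sum_singles:
  "P = (\<Sum>e\<in>Poly_Mapping.keys P. Poly_Mapping.single e (Poly_Mapping.lookup P e))"
  by (rule poly_mapping_eqI) (auto simp: lookup_sum lookup_single when_def in_keys_iff)

text \<open>Each monomial is a constant times powers of its variables. With this rule, identities
  between ring homomorphisms need to be checked only on constants and variables.\<close>

lemma mpolys_induct [consumes 1, case_names const var add mult]:
  fixes P :: "('n::{finite,linorder}, 'a::idom) mpoly"
  assumes P: "P \<in> mpolys V"
    and const: "\<And>c. T (mconst c)" and var: "\<And>i. i \<in> V \<Longrightarrow> T (mvar i)"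
    and add: "\<And>p q. T p \<Longrightarrow> T q \<Longrightarrow> T (p + q)"
    and mult: "\<And>p q. T p \<Longrightarrow> T q \<Longrightarrow> T (p * q)"
  shows "T P"
proof -
  have one: "T 1" using const[of 1] by simp
  have zero: "T 0" using const[of 0] by simp
  have pow: "T (p ^ k)" if "T p" for p k
    using that by (induction k) (auto simp: one mult)
  have mono: "T (Poly_Mapping.single e c)" if "Poly_Mapping.keys e \<subseteq> V" for e c
  proof -
    have "T (\<Prod>i\<in>A. mvar i ^ Poly_Mapping.lookup e i)" if "finite A" for A
      using that
    proof (induction A rule: finite_induct)
      case (insert i A)
      have "T (mvar i ^ Poly_Mapping.lookup e i)"
        using \<open>Poly_Mapping.keys e \<subseteq> V\<close> pow var one in_keys_iff[of i e]
        by (cases "Poly_Mapping.lookup e i = 0") auto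
      then show ?case using insert mult by simp
    qed (simp add: one)
    then show ?thesis unfolding single_eq_monomial using const mult by simp
  qed
  have "T (\<Sum>e\<in>A. Poly_Mapping.single e (Poly_Mapping.lookup P e))"
    if "finite A" "A \<subseteq> Poly_Mapping.keys P" for A
    using that
  proof (induction A rule: finite_induct)
    case (insert e A)
    then show ?case using mono[of e] add P by (auto simp: mpolys_iff_keys)
  qed (simp add: zero)
  then show ?thesis using sum_singles[of P] by (metis finite_keys order_refl)
qed

lemmas mpoly_induct = mpolys_induct[OF mpolys_UNIV, case_names const var add mult]

section \<open>Evaluation as a ring homomorphism\<close>

locale coeff_hom =
  fixes h :: "'a::idom \<Rightarrow> 'b::comm_ring_1"
  assumes hom_0 [simp]: "h 0 = 0" and hom_1 [simp]: "h 1 = 1"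
    and hom_add: "h (a + b) = h a + h b" and hom_mult: "h (a * b) = h a * h b"
begin

lemma eval_superset:
  assumes "finite A" "Poly_Mapping.keys P \<subseteq> A"
  shows "mpoly_eval h g P =
    (\<Sum>e\<in>A. h (Poly_Mapping.lookup P e) * (\<Prod>i\<in>UNIV. g i ^ Poly_Mapping.lookup e i))"
  unfolding mpoly_eval_def
  by (rule sum.mono_neutral_left) (use assms in \<open>auto simp: in_keys_iff\<close>)

lemma eval_add: "mpoly_eval h g (P + Q) = mpoly_eval h g P + mpoly_eval h g Q"
  by (simp add: eval_superset[of "Poly_Mapping.keys P \<union> Poly_Mapping.keys Q"]
      Poly_Mapping.keys_add lookup_add hom_add distrib_right sum.distrib)

lemma eval_0 [simp]: "mpoly_eval h g 0 = 0"
  by (simp add: mpoly_eval_def)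

lemma eval_single:
  "mpoly_eval h g (Poly_Mapping.single e c) = h c * (\<Prod>i\<in>UNIV. g i ^ Poly_Mapping.lookup e i)"
  by (simp add: eval_superset[of "{e}"])

lemma eval_sum: "mpoly_eval h g (sum f A) = (\<Sum>a\<in>A. mpoly_eval h g (f a))"
  by (induction A rule: infinite_finite_induct) (auto simp: eval_add)

lemma eval_mult: "mpoly_eval h g (P * Q) = mpoly_eval h g P * mpoly_eval h g Q"
proof -
  have "P * Q = (\<Sum>d\<in>Poly_Mapping.keys P. \<Sum>e\<in>Poly_Mapping.keys Q.
      Poly_Mapping.single (d + e) (Poly_Mapping.lookup P d * Poly_Mapping.lookup Q e))"
    by (subst (1) sum_singles[of P], subst (1) sum_singles[of Q])
      (simp add: sum_product mult_single)
  also have "mpoly_eval h g \<dots> = mpoly_eval h g P * mpoly_eval h g Q"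
    unfolding eval_sum eval_single mpoly_eval_def[of h g P] mpoly_eval_def[of h g Q] sum_product
    by (intro sum.cong) (auto simp: hom_mult lookup_add power_add prod.distrib ac_simps)
  finally show ?thesis .
qed

lemma eval_const [simp]: "mpoly_eval h g (mconst c) = h c"
  by (simp add: mconst_def eval_single)

lemma eval_1 [simp]: "mpoly_eval h g 1 = 1"
  using eval_const[of g 1] by simp

lemma eval_var [simp]: "mpoly_eval h g (mvar i) = g i"
proof -
  have "(\<Prod>k\<in>UNIV. g k ^ Poly_Mapping.lookup (Poly_Mapping.single i 1) k) =
      (\<Prod>k\<in>UNIV. if k = i then g k else 1)"
    by (intro prod.cong) (auto simp: lookup_single when_def)
  then show ?thesis by (simp add: mvar_def eval_single)
qed

lemma eval_power: "mpoly_eval h g (P ^ k) = mpoly_eval h g P ^ k"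
  by (induction k) (auto simp: eval_mult)

lemma eval_prod: "mpoly_eval h g (prod f A) = (\<Prod>a\<in>A. mpoly_eval h g (f a))"
  by (induction A rule: infinite_finite_induct) (auto simp: eval_mult)

lemma eval_diff: "mpoly_eval h g (P - Q) = mpoly_eval h g P - mpoly_eval h g Q"
  using eval_add[of g "P - Q" Q] by simp

lemma eval_cong:
  assumes "P \<in> mpolys V" "\<And>i. i \<in> V \<Longrightarrow> g i = g' i"
  shows "mpoly_eval h g P = mpoly_eval h g' P"
  unfolding mpoly_eval_def
proof (intro sum.cong refl arg_cong2[where f = "(*)"] prod.cong)
  fix e i assume "e \<in> Poly_Mapping.keys P"
  then have "i \<in> V" if "Poly_Mapping.lookup e i \<noteq> 0"
    using assms(1) that unfolding mpolys_iff_keys in_keys_iff[symmetric] by blast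
  then show "g i ^ Poly_Mapping.lookup e i = g' i ^ Poly_Mapping.lookup e i"
    using assms(2) by (cases "Poly_Mapping.lookup e i = 0") auto
qed

end

text \<open>The three coefficient maps serve three purposes: \<open>mconst\<close> for
  \<open>set_zero\<close>, \<open>rconst\<close> for evaluation at clusters and
  \<open>subst_var\<close>, and constant polynomials for regrouping by powers of one
  variable.\<close>

lemma coeff_hom_mconst: "coeff_hom (mconst :: 'a::idom \<Rightarrow> ('n::{finite,linorder}, 'a) mpoly)"
  by unfold_locales (simp_all add: mconst_add mconst_mult)

lemma coeff_hom_rconst: "coeff_hom (rconst :: 'a::idom \<Rightarrow> ('n::{finite,linorder}, 'a) ratfun)"
  by unfold_locales (simp_all add: rconst_def mconst_add mconst_mult)

lemma coeff_hom_poly: "coeff_hom (\<lambda>c. [:mconst c :: ('n::{finite,linorder}, 'a::idom) mpoly:])"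
  by unfold_locales (simp_all add: mconst_add mconst_mult one_pCons mult.commute)

interpretation mconst: coeff_hom "mconst :: 'a::idom \<Rightarrow> ('n::{finite,linorder}, 'a) mpoly"
  by (rule coeff_hom_mconst)

interpretation rconst: coeff_hom "rconst :: 'a::idom \<Rightarrow> ('n::{finite,linorder}, 'a) ratfun"
  by (rule coeff_hom_rconst)

interpretation poly_const: coeff_hom "\<lambda>c. [:mconst c :: ('n::{finite,linorder}, 'a::idom) mpoly:]"
  by (rule coeff_hom_poly)

lemma eval_rvar [simp]:
  "mpoly_eval rconst rvar P = to_fract (P :: ('n::{finite,linorder}, 'a::idom) mpoly)"
proof (induction P rule: mpoly_induct)
  case (const c)
  then show ?case unfolding rconst.eval_const by (simp add: rconst_def)
next
  case (var i)
  then show ?case unfolding rconst.eval_var by (simp add: rvar_def)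
qed (simp_all add: rconst.eval_add rconst.eval_mult)

text \<open>\<open>P\<close> regrouped by powers of x_i. The coefficients stay in the full
  polynomial ring; that they are free of x_i is recorded by
  \<open>coeff_mpoly_to_poly\<close>.\<close>

definition mpoly_to_poly ::
  "'n::{finite,linorder} \<Rightarrow> ('n, 'a::idom) mpoly \<Rightarrow> ('n, 'a) mpoly poly" where
  "mpoly_to_poly i P =
    mpoly_eval (\<lambda>c. [:mconst c:]) (\<lambda>k. if k = i then [:0, 1:] else [:mvar k:]) P"

lemma mpoly_to_poly_add: "mpoly_to_poly i (P + Q) = mpoly_to_poly i P + mpoly_to_poly i Q"
  by (simp add: mpoly_to_poly_def poly_const.eval_add)

lemma mpoly_to_poly_mult: "mpoly_to_poly i (P * Q) = mpoly_to_poly i P * mpoly_to_poly i Q"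
  by (simp add: mpoly_to_poly_def poly_const.eval_mult)

lemma mpoly_to_poly_0 [simp]: "mpoly_to_poly i 0 = 0"
  by (simp add: mpoly_to_poly_def)

lemma mpoly_to_poly_1 [simp]: "mpoly_to_poly i 1 = 1"
  by (simp add: mpoly_to_poly_def)

lemma mpoly_to_poly_const [simp]: "mpoly_to_poly i (mconst c) = [:mconst c:]"
  unfolding mpoly_to_poly_def by (rule poly_const.eval_const)

lemma mpoly_to_poly_var: "mpoly_to_poly i (mvar k) = (if k = i then [:0, 1:] else [:mvar k:])"
  unfolding mpoly_to_poly_def by (rule poly_const.eval_var)

lemma poly_mpoly_to_poly [simp]: "poly (mpoly_to_poly i P) (mvar i) = P"
  by (induction P rule: mpoly_induct)
    (simp_all add: mpoly_to_poly_add mpoly_to_poly_mult mpoly_to_poly_var)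

lemma mpoly_to_poly_free: "P \<in> mpolys (- {i}) \<Longrightarrow> mpoly_to_poly i P = [:P:]"
  by (induction P rule: mpolys_induct)
    (auto simp: mpoly_to_poly_add mpoly_to_poly_mult mpoly_to_poly_var mult.commute)

lemma mpoly_to_poly_in_polys_over:
  assumes "P \<in> mpolys (insert i V)"
  shows "mpoly_to_poly i P \<in> polys_over (mpolys (V - {i}))"
proof -
  interpret subring_of "mpolys (V - {i}) :: ('a, 'b) mpoly set" by (rule subring_mpolys)
  interpret P: subring_of "polys_over (mpolys (V - {i})) :: ('a, 'b) mpoly poly set"
    by (rule subring_polys_over)
  show ?thesis
    using assms
  proof (induction P rule: mpolys_induct)
    case (var k)
    then show ?case
      by (auto simp: mpoly_to_poly_var const_in_polys_over)
        (auto simp: polys_over_def coeff_pCons split: nat.splits)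
  qed (auto simp: const_in_polys_over mpoly_to_poly_add mpoly_to_poly_mult)
qed

lemma coeff_mpoly_to_poly: "coeff (mpoly_to_poly i P) k \<in> mpolys (- {i})"
  using mpoly_to_poly_in_polys_over[of P i UNIV] by (auto simp: polys_over_def Compl_eq_Diff_UNIV)

text \<open>An x_i hidden in a coefficient would be turned into the formal variable; for
  coefficients free of x_i the regrouping is faithful.\<close>

lemma mpoly_to_poly_poly:
  assumes "p \<in> polys_over (mpolys (- {i}))"
  shows "mpoly_to_poly i (poly p (mvar i)) = p"
  using assms
proof (induction p)
  case (pCons a p)
  have a: "a \<in> mpolys (- {i})" using pCons.prems by (auto simp: polys_over_def dest: spec[of _ 0])
  have "p \<in> polys_over (mpolys (- {i}))"
    using pCons.prems by (auto simp: polys_over_def dest: spec[of _ "Suc _"])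
  then show ?case using pCons.IH a
    by (simp add: mpoly_to_poly_add mpoly_to_poly_mult mpoly_to_poly_var mpoly_to_poly_free)
qed simp

lemma set_zero_eq: "set_zero i P = coeff (mpoly_to_poly i P) 0"
  unfolding set_zero_def
  by (induction P rule: mpoly_induct)
    (simp_all add: mpoly_to_poly_add mpoly_to_poly_mult mpoly_to_poly_var
      mconst.eval_add mconst.eval_mult coeff_mult)

text \<open>The coefficients of \<open>mpoly_to_poly i P\<close> do not see the change of x_i.
  Substitution thereby becomes evaluation of a univariate polynomial, to which Taylor expansion
  applies.\<close>

lemma eval_rvar_upd:
  "mpoly_eval rconst (rvar(i := z)) P = poly (fract_poly (mpoly_to_poly i P)) z"
proof -
  have "mpoly_eval rconst (rvar(i := z)) P =
      mpoly_eval rconst (rvar(i := z)) (poly (mpoly_to_poly i P) (mvar i))" by simp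
  also have "\<dots> = (\<Sum>k\<le>degree (mpoly_to_poly i P).
      mpoly_eval rconst (rvar(i := z)) (coeff (mpoly_to_poly i P) k) * z ^ k)"
    unfolding poly_altdef by (simp add: rconst.eval_sum rconst.eval_mult rconst.eval_power)
  also have "\<dots> = (\<Sum>k\<le>degree (mpoly_to_poly i P). to_fract (coeff (mpoly_to_poly i P) k) * z ^ k)"
  proof (intro sum.cong refl arg_cong2[where f = "(*)"])
    fix k
    have "mpoly_eval rconst (rvar(i := z)) (coeff (mpoly_to_poly i P) k) =
        mpoly_eval rconst rvar (coeff (mpoly_to_poly i P) k)"
      by (rule rconst.eval_cong[OF coeff_mpoly_to_poly[of i P]]) auto
    then show "mpoly_eval rconst (rvar(i := z)) (coeff (mpoly_to_poly i P) k) =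
        to_fract (coeff (mpoly_to_poly i P) k)" by simp
  qed
  finally show ?thesis by (simp add: poly_altdef degree_map_poly coeff_map_poly)
qed

section \<open>Unique factorization and coprimality in A[x_1, ..., x_n]\<close>

lemma rel_dvd_UNIV [simp]: "rel_dvd UNIV a b \<longleftrightarrow> a dvd b"
  by (auto simp: rel_dvd_def dvd_def)

lemma factorial_subring_UNIV: "factorial_subring (UNIV :: 'a::{factorial_semiring,idom} set)"
  unfolding factorial_subring_def
proof (intro ballI impI)
  fix a :: 'a
  assume "a \<noteq> 0"
  then show "\<exists>n. prime_product UNIV n a"
  proof (induction a rule: prime_divisors_induct)
    case (unit u)
    then show ?case by (intro exI[of _ 0] prime_product.unit) auto
  next
    case (factor p a)
    then have "rel_prime UNIV p" by (auto simp: rel_prime_def prime_dvd_mult_iff)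
    then show ?case using factor by (auto intro: prime_product.prime_mult)
  qed simp
qed

text \<open>The polynomials in \<open>insert i V\<close> are the image of the univariate polynomials
  over \<open>mpolys V\<close> under evaluation at x_i, which is injective because those
  coefficients are free of x_i.\<close>

lemma factorial_mpolys:
  "finite V \<Longrightarrow> factorial_subring (mpolys V :: ('n::{finite,linorder}, 'a::{factorial_semiring,idom}) mpoly set)"
proof (induction V rule: finite_induct)
  case empty
  have "mpolys {} = range (mconst :: 'a \<Rightarrow> ('n, 'a) mpoly)"
  proof
    show "mpolys {} \<subseteq> range (mconst :: 'a \<Rightarrow> ('n, 'a) mpoly)"
    proof
      fix P :: "('n, 'a) mpoly" assume "P \<in> mpolys {}"
      then show "P \<in> range mconst"
        by (induction P rule: mpolys_induct)
          (auto simp: mconst_add[symmetric] mconst_mult[symmetric])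
    qed
  qed auto
  moreover have "factorial_subring (range (mconst :: 'a \<Rightarrow> ('n, 'a) mpoly))"
    by (rule factorial_subring_image[OF factorial_subring_UNIV])
      (auto simp: inj_def mconst_mult intro!: subring_of.intro)
  ultimately show ?case by simp
next
  case (insert i V)
  let ?\<psi> = "\<lambda>p :: ('n, 'a) mpoly poly. poly p (mvar i)"
  have VV: "V - {i} = V" using insert by simp
  have sub: "polys_over (mpolys V) \<subseteq> polys_over (mpolys (- {i}) :: ('n, 'a) mpoly set)"
    using insert mpolys_mono[of V "- {i}"] by (auto simp: polys_over_def)
  have inj: "inj_on ?\<psi> (polys_over (mpolys V))"
    using mpoly_to_poly_poly sub by (metis (no_types, lifting) inj_onI subsetD)
  have "?\<psi> ` polys_over (mpolys V) = mpolys (insert i V)"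
  proof
    show "mpolys (insert i V) \<subseteq> ?\<psi> ` polys_over (mpolys V)"
    proof
      fix P :: "('n, 'a) mpoly" assume "P \<in> mpolys (insert i V)"
      then have "mpoly_to_poly i P \<in> polys_over (mpolys V)"
        using mpoly_to_poly_in_polys_over VV by metis
      then show "P \<in> ?\<psi> ` polys_over (mpolys V)"
        by (intro image_eqI[of _ _ "mpoly_to_poly i P"]) auto
    qed
    show "?\<psi> ` polys_over (mpolys V) \<subseteq> mpolys (insert i V)"
      using mpolys_mono[of V "insert i V"]
      by (auto simp: polys_over_def intro!: subring_of.poly_closed[OF subring_mpolys])
  qed
  moreover have "factorial_subring (?\<psi> ` polys_over (mpolys V))"
    by (rule factorial_subring_image[OF subring_of.factorial_polys_over[OF subring_mpolys insert.IH]])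
      (auto simp: inj subring_of.subring_polys_over[OF subring_mpolys])
  ultimately show ?case by simp
qed

text \<open>In a factorial ring this is coprimality of \<open>z\<close> and \<open>w\<close>.\<close>

definition cancels :: "'b::idom set \<Rightarrow> 'b \<Rightarrow> 'b \<Rightarrow> bool" where
  "cancels S z w \<longleftrightarrow> (\<forall>f\<in>S. rel_dvd S z (f * w) \<longrightarrow> rel_dvd S z f)"

lemma cancelsD: "cancels S z w \<Longrightarrow> rel_dvd S z (f * w) \<Longrightarrow> f \<in> S \<Longrightarrow> rel_dvd S z f"
  by (auto simp: cancels_def)

lemma (in subring_of) cancels_mult:
  assumes "cancels S z v" "cancels S z w" "v \<in> S"
  shows "cancels S z (v * w)"
  using assms by (auto simp: cancels_def mult.assoc[symmetric])

lemma (in subring_of) cancels_power: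
  assumes "cancels S z w" "w \<in> S"
  shows "cancels S z (w ^ n)"
proof (induction n)
  case (Suc n)
  then show ?case using cancels_mult[OF assms(1) Suc assms(2)] by simp
qed (simp add: cancels_def)

text \<open>One factor \<open>z\<close> at a time: it divides \<open>f\<close>, is cancelled from
  both sides, and the rest is the induction hypothesis.\<close>

lemma (in subring_of) cancels_power_left:
  assumes "cancels S z w" "z \<in> S" "z \<noteq> 0" "w \<in> S"
  shows "cancels S (z ^ n) w"
proof (induction n)
  case 0
  show ?case using rel_dvdI[of _ S 1] by (auto simp: cancels_def)
next
  case (Suc n)
  show ?case
    unfolding cancels_def
  proof (intro ballI impI)
    fix f assume f: "f \<in> S" "rel_dvd S (z ^ Suc n) (f * w)"
    then obtain g where g: "g \<in> S" "f * w = z * (z ^ n * g)" by (auto simp: rel_dvd_def mult.assoc)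
    then have "rel_dvd S z (f * w)" using assms rel_dvdI[of "z ^ n * g" S z] by simp
    then obtain h where h: "h \<in> S" "f = z * h"
      using assms f by (auto simp: cancels_def elim: rel_dvdE)
    then have "z * (h * w) = z * (z ^ n * g)" using g by (simp add: mult.assoc)
    then have "h * w = z ^ n * g" using assms by simp
    then have "rel_dvd S (z ^ n) (h * w)" using g rel_dvdI by simp
    then have "rel_dvd S (z ^ n) h" using Suc h by (auto simp: cancels_def)
    then obtain k where "k \<in> S" "h = z ^ n * k" by (rule rel_dvdE)
    then have "f = z ^ Suc n * k" using h by (simp add: mult.assoc)
    then show "rel_dvd S (z ^ Suc n) f" using \<open>k \<in> S\<close> rel_dvdI by blast
  qed
qed

lemma subring_UNIV: "subring_of UNIV"
  by unfold_locales auto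

text \<open>Unique factorization enters here: the prime factors of \<open>P\<close> are removed one
  by one, each dividing \<open>f\<close> because it cannot divide \<open>w\<close>.\<close>

lemma coprime_elems_cancels:
  fixes P w :: "('n::{finite,linorder}, 'a::{factorial_semiring,idom}) mpoly"
  assumes "P \<noteq> 0" "coprime_elems P w"
  shows "cancels UNIV P w"
proof -
  have "mpolys UNIV = (UNIV :: ('n, 'a) mpoly set)" by auto
  then obtain n where "prime_product UNIV n P"
    using factorial_mpolys[of UNIV] assms(1) unfolding factorial_subring_def by (metis finite UNIV_I)
  then show ?thesis
    using assms(2)
  proof (induction rule: prime_product.induct)
    case (unit u)
    then have "u dvd f" for f using dvd_trans[of u 1 f] by simp
    then show ?case by (simp add: cancels_def)
  next
    case (prime_mult p n a)
    have "coprime_elems a w" using prime_mult.prems unfolding coprime_elems_def by auto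
    then have IH: "cancels UNIV a w" by (rule prime_mult.IH)
    have p: "\<And>a b. p dvd a * b \<Longrightarrow> p dvd a \<or> p dvd b" "\<not> p dvd 1" "p \<noteq> 0"
      using prime_mult.hyps(1) by (auto simp: rel_prime_def)
    then have pw: "\<not> p dvd w" using prime_mult.prems by (auto simp: coprime_elems_def)
    show ?case
      unfolding cancels_def rel_dvd_UNIV
    proof (intro ballI impI)
      fix f assume f: "p * a dvd f * w"
      then have "p dvd f * w" by (rule dvd_mult_left)
      then obtain f' where f': "f = p * f'" using p pw by (meson dvdE)
      then have "a dvd f' * w" using f p by (simp add: mult.assoc)
      then have "a dvd f'" using cancelsD[OF IH, of f'] by simp
      then show "p * a dvd f" using f' by simp
    qed
  qed
qed

text \<open>x_i divides a polynomial exactly when the constant coefficient in x_i vanishes, and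
  these coefficients lie in an integral domain.\<close>

lemma mvar_prime:
  fixes a b :: "('n::{finite,linorder}, 'a::idom) mpoly"
  assumes "mvar i dvd a * b"
  shows "mvar i dvd a \<or> mvar i dvd b"
proof -
  have dvd: "mvar i dvd P" if "coeff (mpoly_to_poly i P) 0 = 0" for P :: "('n, 'a) mpoly"
  proof -
    obtain c p where p: "mpoly_to_poly i P = pCons c p" by (cases "mpoly_to_poly i P")
    with that have "c = 0" by simp
    then have "P = mvar i * poly p (mvar i)"
      using p poly_mpoly_to_poly[of i P] by simp
    then show ?thesis by (metis dvd_triv_left)
  qed
  obtain q where "a * b = mvar i * q" using assms by auto
  then have "mpoly_to_poly i a * mpoly_to_poly i b = [:0, 1:] * mpoly_to_poly i q"
    by (metis mpoly_to_poly_mult mpoly_to_poly_var)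
  then have "coeff (mpoly_to_poly i a) 0 * coeff (mpoly_to_poly i b) 0 = 0"
    by (metis (no_types, lifting) coeff_mult_0 coeff_pCons_0 mult_zero_left)
  then show ?thesis using dvd by auto
qed

text \<open>As x_i is prime and does not divide \<open>P\<close>, the factor x_i in
  \<open>f * x_i = P * g\<close> can be taken out of \<open>g\<close>.\<close>

lemma cancels_mvar:
  fixes P :: "('n::{finite,linorder}, 'a::idom) mpoly"
  assumes "\<not> mvar i dvd P"
  shows "cancels UNIV P (mvar i)"
  unfolding cancels_def rel_dvd_UNIV
proof (intro ballI impI)
  fix f assume "P dvd f * mvar i"
  then obtain g where g: "f * mvar i = P * g" by auto
  then have "mvar i dvd P * g" by (metis dvd_triv_right)
  then have "mvar i dvd g" using mvar_prime assms by blast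
  then obtain k where "g = mvar i * k" by auto
  then have "mvar i * f = mvar i * (P * k)" using g by (simp add: ac_simps)
  then show "P dvd f" by simp
qed

text \<open>Since \<open>P\<close>, \<open>A\<close> and \<open>B\<close> are free of x_i,
  coefficients of powers of x_i can be compared. From the top degree downwards, \<open>P\<close>
  divides \<open>B\<close> times the current coefficient of \<open>f\<close>, because it divides the
  one above; then \<open>B\<close> is cancelled.\<close>

lemma cancels_linear:
  fixes P :: "('n::{finite,linorder}, 'a::idom) mpoly"
  assumes "P \<in> mpolys (- {i})" "A \<in> mpolys (- {i})" "B \<in> mpolys (- {i})" "cancels UNIV P B"
  shows "cancels UNIV P (A + B * mvar i)"
  unfolding cancels_def rel_dvd_UNIV
proof (intro ballI impI)
  fix f assume "P dvd f * (A + B * mvar i)"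
  then obtain g where g: "f * (A + B * mvar i) = P * g" by auto
  define p where "p = mpoly_to_poly i f"
  define q where "q = mpoly_to_poly i g"
  have "p * ([:A:] + [:B:] * [:0, 1:]) = [:P:] * q"
    using arg_cong[OF g, of "mpoly_to_poly i"] assms
    by (simp add: mpoly_to_poly_mult mpoly_to_poly_add mpoly_to_poly_var mpoly_to_poly_free p_def q_def
        del: mult_pCons_left mult_pCons_right)
  then have "smult A p + pCons 0 (smult B p) = smult P q"
    by simp
  then have rec: "A * coeff p (Suc k) + B * coeff p k = P * coeff q (Suc k)" for k
    by (metis coeff_add coeff_pCons_Suc coeff_smult)
  \<comment> \<open>\<open>k\<close> counts downwards from the vanishing coefficient of index
    \<open>Suc (degree p)\<close>; once the subtraction is truncated at 0 the claim merely repeats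
    itself.\<close>
  have "P dvd coeff p (Suc (degree p) - k)" for k
  proof (induction k)
    case 0
    have "coeff p (Suc (degree p)) = 0" by (rule coeff_eq_0) simp
    then show ?case by simp
  next
    case (Suc k)
    show ?case
    proof (cases "k \<le> degree p")
      case True
      then have eq: "Suc (degree p) - k = Suc (degree p - k)" by simp
      have "B * coeff p (degree p - k) =
          P * coeff q (Suc (degree p - k)) - A * coeff p (Suc (degree p - k))"
        using rec[of "degree p - k"] by (simp add: algebra_simps)
      moreover have "P dvd A * coeff p (Suc (degree p - k))" using Suc unfolding eq by (rule dvd_mult)
      ultimately have "P dvd B * coeff p (degree p - k)" by simp
      then have "P dvd coeff p (degree p - k) * B" by (simp add: mult.commute)
      then have "P dvd coeff p (degree p - k)"
        using cancelsD[OF assms(4), of "coeff p (degree p - k)"] by simp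
      then show ?thesis by simp
    next
      case False
      then show ?thesis using Suc by simp
    qed
  qed
  from this[of "Suc (degree p) - _"] have "P dvd coeff p k" if "k \<le> degree p" for k
    using that by (metis diff_diff_cancel le_SucI)
  then have "P dvd poly p (mvar i)"
    unfolding poly_altdef by (intro dvd_sum dvd_mult2) auto
  then show "P dvd f" by (simp add: p_def)
qed

section \<open>Laurent polynomials and substitution\<close>

lemma rvar_nonzero [simp]: "rvar i \<noteq> (0 :: ('n::{finite,linorder}, 'a::idom) ratfun)"
  by (simp add: rvar_def)

text \<open>For nonzero \<open>y\<close> this is the ring generated by the constants and the
  \<open>y k\<close> with their inverses, \<open>k\<close> in \<open>V\<close>. A single common
  denominator makes ring operations reduce to operations on \<open>F\<close>.\<close>

definition laurent_ring ::
  "'n set \<Rightarrow> ('n::{finite,linorder} \<Rightarrow> ('n, 'a::idom) ratfun) \<Rightarrow> ('n, 'a) ratfun set" where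
  "laurent_ring V y =
    {f. \<exists>N. \<exists>F\<in>mpolys V. f * (\<Prod>k\<in>V. y k) ^ N = mpoly_eval rconst y F}"

lemma laurent_ringI:
  "F \<in> mpolys V \<Longrightarrow> f * (\<Prod>k\<in>V. y k) ^ N = mpoly_eval rconst y F \<Longrightarrow> f \<in> laurent_ring V y"
  by (auto simp: laurent_ring_def)

lemma laurent_ringE:
  assumes "f \<in> laurent_ring V y"
  obtains N F where "F \<in> mpolys V" "f * (\<Prod>k\<in>V. y k) ^ N = mpoly_eval rconst y F"
  using assms by (auto simp: laurent_ring_def)

lemma prod_mvar_in_mpolys: "W \<subseteq> V \<Longrightarrow>
    (\<Prod>k\<in>W. mvar k) \<in> (mpolys V :: ('n::{finite,linorder}, 'a::idom) mpoly set)"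
  by (rule subring_of.prod_closed[OF subring_mpolys]) auto

lemma eval_in_laurent_ring: "F \<in> mpolys V \<Longrightarrow> mpoly_eval rconst y F \<in> laurent_ring V y"
  by (rule laurent_ringI[of F _ _ _ 0]) auto

lemma subring_laurent_ring: "subring_of (laurent_ring V y)"
proof
  interpret subring_of "mpolys V :: ('a, 'b) mpoly set" by (rule subring_mpolys)
  let ?p = "\<Prod>k\<in>V. y k" and ?m = "(\<Prod>k\<in>V. mvar k) :: ('a, 'b) mpoly"
  have m: "?m \<in> mpolys V" by (rule prod_mvar_in_mpolys) simp
  have evm: "mpoly_eval rconst y ?m = ?p" by (simp add: rconst.eval_prod)
  show "0 \<in> laurent_ring V y" "1 \<in> laurent_ring V y"
    using eval_in_laurent_ring[of 0 V y] eval_in_laurent_ring[of 1 V y] by simp_all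
  fix f g assume "f \<in> laurent_ring V y" "g \<in> laurent_ring V y"
  then obtain N F M G where F: "F \<in> mpolys V" "f * ?p ^ N = mpoly_eval rconst y F"
    and G: "G \<in> mpolys V" "g * ?p ^ M = mpoly_eval rconst y G"
    by (metis laurent_ringE)
  have "(f - g) * ?p ^ (N + M) = (f * ?p ^ N) * ?p ^ M - (g * ?p ^ M) * ?p ^ N"
    by (simp add: power_add algebra_simps)
  also have "\<dots> = mpoly_eval rconst y (F * ?m ^ M - G * ?m ^ N)"
    unfolding F G by (simp add: rconst.eval_diff rconst.eval_mult rconst.eval_power evm)
  finally show "f - g \<in> laurent_ring V y"
    by (rule laurent_ringI[rotated]) (use F G m in simp)
  have "(f * g) * ?p ^ (N + M) = (f * ?p ^ N) * (g * ?p ^ M)"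
    by (simp add: power_add algebra_simps)
  also have "\<dots> = mpoly_eval rconst y (F * G)"
    unfolding F G by (simp add: rconst.eval_mult)
  finally show "f * g \<in> laurent_ring V y"
    by (rule laurent_ringI[rotated]) (use F G in simp)
qed

lemma inverse_in_laurent_ring:
  assumes "k \<in> V" "y k \<noteq> 0"
  shows "inverse (y k) \<in> laurent_ring V y"
\<comment> \<open>The inverse of \<open>y k\<close> is the product of the other elements divided by
  the product of all.\<close>
proof (rule laurent_ringI[of "\<Prod>k\<in>V - {k}. mvar k" _ _ _ 1])
  have "(\<Prod>k\<in>V. y k) = y k * (\<Prod>k\<in>V - {k}. y k)"
    using assms by (intro prod.remove) auto
  then show "inverse (y k) * (\<Prod>k\<in>V. y k) ^ 1 = mpoly_eval rconst y (\<Prod>k\<in>V - {k}. mvar k)"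
    using assms by (simp add: rconst.eval_prod)
qed (rule prod_mvar_in_mpolys, auto)

lemma var_in_laurent_ring: "k \<in> V \<Longrightarrow> y k \<in> laurent_ring V y"
  using eval_in_laurent_ring[of "mvar k" V y] by simp

lemma powi_in_laurent_ring:
  assumes "k \<in> V" "y k \<noteq> 0"
  shows "y k powi a \<in> laurent_ring V y"
  using var_in_laurent_ring[of k V y, OF assms(1)] inverse_in_laurent_ring[of k V y, OF assms]
    subring_of.power_closed[OF subring_laurent_ring]
  by (auto simp: power_int_def)

lemma to_fract_in_laurent_ring: "F \<in> mpolys V \<Longrightarrow> to_fract F \<in> laurent_ring V rvar"
  using eval_in_laurent_ring[of F V rvar] by simp

lemma laurent_ring_mono:
  assumes "V \<subseteq> W"
  shows "laurent_ring V y \<subseteq> laurent_ring W y"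
proof
  fix f assume "f \<in> laurent_ring V y"
  then obtain N F where F: "F \<in> mpolys V" "f * (\<Prod>k\<in>V. y k) ^ N = mpoly_eval rconst y F"
    by (rule laurent_ringE)
  let ?m = "(\<Prod>k\<in>W - V. mvar k) :: ('a, 'b) mpoly"
  have "(\<Prod>k\<in>W. y k) = (\<Prod>k\<in>W - V. y k) * (\<Prod>k\<in>V. y k)"
    using assms by (intro prod.subset_diff) auto
  then have "f * (\<Prod>k\<in>W. y k) ^ N = mpoly_eval rconst y (F * ?m ^ N)"
    using F by (simp add: power_mult_distrib rconst.eval_mult rconst.eval_power rconst.eval_prod
        ac_simps)
  moreover have "F * ?m ^ N \<in> mpolys W"
    using F mpolys_mono[OF assms] prod_mvar_in_mpolys[of "W - V" W]
    by (intro subring_of.mult_closed[OF subring_mpolys] subring_of.power_closed[OF subring_mpolys]) auto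
  ultimately show "f \<in> laurent_ring W y" using laurent_ringI by blast
qed

section \<open>Algebraic independence and substitution of a cluster\<close>

definition alg_indep :: "('n::{finite,linorder} \<Rightarrow> ('n, 'a::idom) ratfun) \<Rightarrow> bool" where
  "alg_indep y \<longleftrightarrow> (\<forall>F. mpoly_eval rconst y F = 0 \<longrightarrow> F = 0)"

text \<open>The substitution of \<open>y\<close> for the variables, which is a field endomorphism
  only for algebraically independent \<open>y\<close>.\<close>

definition fract_subst ::
  "('n::{finite,linorder} \<Rightarrow> ('n, 'a::idom) ratfun) \<Rightarrow> ('n, 'a) ratfun \<Rightarrow> ('n, 'a) ratfun" where
  "fract_subst y r = (SOME w. \<exists>F G. G \<noteq> 0 \<and> r = Fract F G \<and>
    w = mpoly_eval rconst y F / mpoly_eval rconst y G)"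

context
  fixes y :: "'n::{finite,linorder} \<Rightarrow> ('n, 'a::idom) ratfun"
  assumes indep: "alg_indep y"
begin

lemma eval_eq_0_iff: "mpoly_eval rconst y F = 0 \<longleftrightarrow> F = 0"
  using indep by (auto simp: alg_indep_def)

lemma alg_indep_nonzero: "y k \<noteq> 0"
  using eval_eq_0_iff[of "mvar k"] by simp

text \<open>Algebraic independence keeps denominators nonzero, so the quotient does not depend on
  the fraction chosen to represent the argument.\<close>

lemma fract_subst_Fract:
  assumes "G \<noteq> 0"
  shows "fract_subst y (Fract F G) = mpoly_eval rconst y F / mpoly_eval rconst y G"
  unfolding fract_subst_def
proof (rule some_equality)
  fix w assume "\<exists>F' G'. G' \<noteq> 0 \<and> Fract F G = Fract F' G' \<and>
    w = mpoly_eval rconst y F' / mpoly_eval rconst y G'"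
  then obtain F' G' where *: "G' \<noteq> 0" "Fract F G = Fract F' G'"
    "w = mpoly_eval rconst y F' / mpoly_eval rconst y G'" by blast
  then have "F * G' = F' * G" using assms by (simp add: eq_fract)
  then have "mpoly_eval rconst y F * mpoly_eval rconst y G' =
      mpoly_eval rconst y F' * mpoly_eval rconst y G"
    by (simp add: rconst.eval_mult[symmetric])
  then show "w = mpoly_eval rconst y F / mpoly_eval rconst y G"
    using assms * eval_eq_0_iff by (simp add: frac_eq_eq)
qed (use assms in blast)

lemma fract_subst_to_fract: "fract_subst y (to_fract F) = mpoly_eval rconst y F"
  by (simp add: to_fract_def fract_subst_Fract)

lemma fract_subst_add: "fract_subst y (r + s) = fract_subst y r + fract_subst y s"
proof -
  obtain F G where r: "r = Fract F G" "G \<noteq> 0" by (cases r)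
  obtain F' G' where s: "s = Fract F' G'" "G' \<noteq> 0" by (cases s)
  show ?thesis using r s eval_eq_0_iff
    by (simp add: fract_subst_Fract rconst.eval_add rconst.eval_mult add_frac_eq)
qed

lemma fract_subst_mult: "fract_subst y (r * s) = fract_subst y r * fract_subst y s"
proof -
  obtain F G where r: "r = Fract F G" "G \<noteq> 0" by (cases r)
  obtain F' G' where s: "s = Fract F' G'" "G' \<noteq> 0" by (cases s)
  show ?thesis using r s by (simp add: fract_subst_Fract rconst.eval_mult)
qed

lemma fract_subst_1 [simp]: "fract_subst y 1 = 1"
  using fract_subst_to_fract[of 1] by simp

lemma fract_subst_0 [simp]: "fract_subst y 0 = 0"
  using fract_subst_to_fract[of 0] by simp

lemma fract_subst_diff: "fract_subst y (r - s) = fract_subst y r - fract_subst y s"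
  using fract_subst_add[of "r - s" s] by simp

lemma fract_subst_power: "fract_subst y (r ^ n) = fract_subst y r ^ n"
  by (induction n) (simp_all add: fract_subst_mult)

lemma fract_subst_prod: "fract_subst y (prod f A) = (\<Prod>a\<in>A. fract_subst y (f a))"
  by (induction A rule: infinite_finite_induct) (simp_all add: fract_subst_mult)

lemma fract_subst_eq_0_iff [simp]: "fract_subst y r = 0 \<longleftrightarrow> r = 0"
proof
  assume "fract_subst y r = 0"
  moreover have "r \<noteq> 0 \<Longrightarrow> fract_subst y r * fract_subst y (inverse r) = 1"
    by (simp add: fract_subst_mult[symmetric])
  ultimately show "r = 0" by auto
qed simp

lemma fract_subst_eq_iff [simp]: "fract_subst y r = fract_subst y s \<longleftrightarrow> r = s"
  using fract_subst_eq_0_iff[of "r - s"] by (simp add: fract_subst_diff)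

lemma fract_subst_rvar [simp]: "fract_subst y (rvar k) = y k"
  by (simp add: rvar_def fract_subst_to_fract)

lemma fract_subst_divide: "fract_subst y (r / s) = fract_subst y r / fract_subst y s"
proof (cases "s = 0")
  case False
  then have "fract_subst y (r / s) * fract_subst y s = fract_subst y r"
    by (simp add: fract_subst_mult[symmetric])
  then show ?thesis using False by (simp add: eq_divide_eq)
qed simp

lemma fract_subst_eval:
  fixes P :: "('n, 'a) mpoly"
  shows "fract_subst y (mpoly_eval rconst g P) = mpoly_eval rconst (\<lambda>k. fract_subst y (g k)) P"
proof (induction P rule: mpoly_induct)
  case (const c)
  then show ?case
    unfolding rconst.eval_const unfolding rconst_def fract_subst_to_fract rconst.eval_const ..
qed (simp_all add: rconst.eval_add rconst.eval_mult fract_subst_add fract_subst_mult)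

text \<open>This lets divisibility questions about the Laurent ring of any independent cluster be
  settled in the variables themselves.\<close>

lemma laurent_ring_eq_image: "laurent_ring V y = fract_subst y ` laurent_ring V rvar"
proof
  show "fract_subst y ` laurent_ring V rvar \<subseteq> laurent_ring V y"
  proof
    fix g assume "g \<in> fract_subst y ` laurent_ring V rvar"
    then obtain f where f: "g = fract_subst y f" "f \<in> laurent_ring V rvar" by blast
    from f(2) obtain N F where F: "F \<in> mpolys V" "f * (\<Prod>k\<in>V. rvar k) ^ N = to_fract F"
      by (auto elim: laurent_ringE)
    have "g * (\<Prod>k\<in>V. y k) ^ N = fract_subst y (f * (\<Prod>k\<in>V. rvar k) ^ N)"
      by (simp add: f fract_subst_mult fract_subst_power fract_subst_prod)
    then show "g \<in> laurent_ring V y"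
      using F by (intro laurent_ringI) (auto simp: fract_subst_to_fract)
  qed
  show "laurent_ring V y \<subseteq> fract_subst y ` laurent_ring V rvar"
  proof
    fix g assume "g \<in> laurent_ring V y"
    then obtain N F where F: "F \<in> mpolys V" "g * (\<Prod>k\<in>V. y k) ^ N = mpoly_eval rconst y F"
      by (rule laurent_ringE)
    let ?p = "\<Prod>k\<in>V. rvar k :: ('n, 'a) ratfun"
    have "?p ^ N \<noteq> 0" by simp
    then have "to_fract F / ?p ^ N \<in> laurent_ring V rvar"
      using F by (intro laurent_ringI[of F _ _ _ N]) auto
    moreover have "(\<Prod>k\<in>V. y k) ^ N \<noteq> 0" using alg_indep_nonzero by simp
    then have "fract_subst y (to_fract F / ?p ^ N) = g"
      using F(2) by (simp add: fract_subst_divide fract_subst_power fract_subst_prod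
          fract_subst_to_fract divide_eq_eq)
    ultimately show "g \<in> fract_subst y ` laurent_ring V rvar" by blast
  qed
qed

end

lemma alg_indep_rvar: "alg_indep rvar"
  by (simp add: alg_indep_def)

text \<open>Clearing the denominators of \<open>F\<close> at x_i = P / x_i by x_i to the power
  \<open>N\<close> reverses the order of its coefficients and multiplies the \<open>k\<close>-th one
  by \<open>P ^ k\<close>. The result \<open>g\<close> still has coefficients free of x_i, so its
  vanishing at x_i kills them all.\<close>

lemma alg_indep_mutation_rvar:
  fixes P :: "('n::{finite,linorder}, 'a::idom) mpoly"
  assumes P: "P \<in> mpolys (- {i})" "P \<noteq> 0"
  shows "alg_indep (rvar(i := to_fract P / rvar i))"
  unfolding alg_indep_def
proof (intro allI impI)
  interpret subring_of "mpolys (- {i}) :: ('n, 'a) mpoly set" by (rule subring_mpolys)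
  fix F :: "('n, 'a) mpoly"
  define f where "f = mpoly_to_poly i F"
  define N where "N = degree f"
  define g where "g = (\<Sum>k\<le>N. monom (coeff f k * P ^ k) (N - k))"
  assume "mpoly_eval rconst (rvar(i := to_fract P / rvar i)) F = 0"
  then have "poly (fract_poly f) (to_fract P / rvar i) = 0" by (simp add: eval_rvar_upd f_def)
  then have "0 = (\<Sum>k\<le>N. to_fract (coeff f k) * (to_fract P / rvar i) ^ k) * rvar i ^ N"
    by (simp add: poly_altdef degree_map_poly coeff_map_poly N_def)
  also have "\<dots> = (\<Sum>k\<le>N. to_fract (coeff f k * P ^ k * mvar i ^ (N - k)))"
    unfolding sum_distrib_right
  proof (intro sum.cong refl)
    fix k assume "k \<in> {..N}"
    then have "rvar i ^ N = rvar i ^ k * (rvar i ^ (N - k) :: ('n, 'a) ratfun)"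
      by (simp flip: power_add)
    moreover have "to_fract (a ^ n) = to_fract a ^ n" for a :: "('n, 'a) mpoly" and n
      by (induction n) simp_all
    ultimately show "to_fract (coeff f k) * (to_fract P / rvar i) ^ k * rvar i ^ N =
        to_fract (coeff f k * P ^ k * mvar i ^ (N - k))"
      by (simp add: power_divide rvar_def)
  qed
  also have "\<dots> = to_fract (poly g (mvar i))"
    by (simp add: g_def poly_sum poly_monom)
  finally have g0: "poly g (mvar i) = 0" by simp
  have "coeff f k \<in> mpolys (- {i})" for k unfolding f_def by (rule coeff_mpoly_to_poly)
  then have "g \<in> polys_over (mpolys (- {i}))"
    using P unfolding g_def polys_over_def by (auto simp: coeff_sum coeff_monom intro!: sum_closed)
  then have "g = 0" using mpoly_to_poly_poly[of g i] g0 by simp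
  have "coeff f k = 0" if "k \<le> N" for k
  proof -
    have "coeff g (N - k) = (\<Sum>l\<le>N. if l = k then coeff f l * P ^ l else 0)"
      unfolding g_def coeff_sum coeff_monom using that by (intro sum.cong) auto
    then show ?thesis using \<open>g = 0\<close> that P by simp
  qed
  then have "f = 0" using leading_coeff_0_iff[of f] by (simp add: N_def)
  then show "F = 0" using poly_mpoly_to_poly[of i F] by (simp add: f_def)
qed

lemma fract_subst_upd:
  "alg_indep y \<Longrightarrow> (\<lambda>k. fract_subst y ((rvar(i := w)) k)) = y(i := fract_subst y w)"
  by (auto simp: fun_eq_iff)

text \<open>Substitution of \<open>y\<close>, which is injective, reduces the claim to the case of
  the variables.\<close>

lemma alg_indep_mutation:
  assumes y: "alg_indep y" and P: "P \<in> mpolys (- {i})" "P \<noteq> 0"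
    and z: "y i * z = mpoly_eval rconst y P"
  shows "alg_indep (y(i := z))"
proof -
  have z': "z = fract_subst y (to_fract P / rvar i)"
    using z alg_indep_nonzero[OF y, of i]
    by (simp add: fract_subst_divide[OF y] fract_subst_to_fract[OF y] fract_subst_rvar[OF y]
        eq_divide_eq mult.commute)
  have "mpoly_eval rconst (y(i := z)) F =
      fract_subst y (mpoly_eval rconst (rvar(i := to_fract P / rvar i)) F)" for F
    unfolding fract_subst_eval[OF y] fract_subst_upd[OF y] z' ..
  then show ?thesis
    using alg_indep_mutation_rvar[OF P] fract_subst_eq_0_iff[OF y] by (simp add: alg_indep_def)
qed

section \<open>Taylor expansion, and coprimality in Laurent rings\<close>

lemma (in subring_of) of_nat_closed: "of_nat n \<in> S"
  by (induction n) auto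

text \<open>Horner's scheme produces the remainder \<open>c\<close> without dividing by factorials,
  so it stays in \<open>S\<close>. Second order is called for because \<open>v\<close> is obtained
  by a division by \<open>z\<close> and is afterwards read modulo \<open>z\<close>.\<close>

lemma (in subring_of) poly_taylor:
  assumes "p \<in> polys_over S" "w \<in> S" "s \<in> S"
  shows "\<exists>c\<in>S. poly p (w + s) = poly p w + s * poly (pderiv p) w + s\<^sup>2 * c"
    and "poly (pderiv p) w \<in> S"
proof -
  have D: "poly (pderiv p) w \<in> S" if "p \<in> polys_over S" for p
    using that assms of_nat_closed
    by (intro poly_closed) (auto simp: coeff_pderiv polys_over_def simp del: of_nat_Suc)
  show "poly (pderiv p) w \<in> S" using D assms(1) .
  show "\<exists>c\<in>S. poly p (w + s) = poly p w + s * poly (pderiv p) w + s\<^sup>2 * c"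
    using assms(1)
  proof (induction p)
    case (pCons a p)
    have p: "p \<in> polys_over S"
      using pCons.prems by (auto simp: polys_over_def dest: spec[of _ "Suc _"])
    then obtain c where c: "c \<in> S" "poly p (w + s) = poly p w + s * poly (pderiv p) w + s\<^sup>2 * c"
      using pCons.IH by blast
    have "poly (pCons a p) (w + s) = poly (pCons a p) w + s * poly (pderiv (pCons a p)) w
        + s\<^sup>2 * (poly (pderiv p) w + (w + s) * c)"
      using c(2) by (simp add: pderiv_pCons algebra_simps power2_eq_square)
    then show ?case using c(1) D[OF p] assms by (metis add_closed mult_closed)
  qed (auto intro: bexI[of _ 0])
qed

lemma fract_poly_in_polys_over:
  "p \<in> polys_over (mpolys V) \<Longrightarrow> fract_poly p \<in> polys_over (laurent_ring V rvar)"
  by (auto simp: polys_over_def coeff_map_poly intro: to_fract_in_laurent_ring)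

lemma (in subring_of) cancels_unit:
  assumes "u \<in> S" "rel_dvd S u 1"
  shows "cancels S z u"
  unfolding cancels_def
proof (intro ballI impI)
  fix f assume f: "f \<in> S" "rel_dvd S z (f * u)"
  obtain v where v: "v \<in> S" "1 = u * v" using assms(2) by (rule rel_dvdE)
  have "(f * u) * v = f" using v(2) by (simp add: mult.assoc)
  then show "rel_dvd S z f" using rel_dvd_mult[OF f(2) v(1)] by metis
qed

lemma (in subring_of) cancels_unit_left:
  assumes "u \<in> S" "rel_dvd S u 1" "cancels S z w"
  shows "cancels S (z * u) w"
  unfolding cancels_def
proof (intro ballI impI)
  fix f assume f: "f \<in> S" "rel_dvd S (z * u) (f * w)"
  obtain v where v: "v \<in> S" "1 = u * v" using assms(2) by (rule rel_dvdE)
  from f(2) obtain g where g: "g \<in> S" "f * w = z * u * g" by (rule rel_dvdE)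
  then have "rel_dvd S z (f * w)" using rel_dvdI[of "u * g" S z] assms by (simp add: mult.assoc)
  then have "rel_dvd S z f" using cancelsD[OF assms(3)] f by blast
  then obtain h where h: "h \<in> S" "f = z * h" by (rule rel_dvdE)
  have "f = z * (u * v) * h" using h v(2) by simp
  then have "f = z * u * (v * h)" by (simp only: ac_simps)
  then show "rel_dvd S (z * u) f" using h(1) v(1) rel_dvdI[of "v * h" S "z * u"] by (metis mult_closed)
qed

lemma (in subring_of) cancels_add_multiple:
  assumes "cancels S z w" "c \<in> S"
  shows "cancels S z (w + z * c)"
  unfolding cancels_def
proof (intro ballI impI)
  fix f assume f: "f \<in> S" "rel_dvd S z (f * (w + z * c))"
  have "rel_dvd S z (z * (f * c))" using f assms by (intro rel_dvdI) simp
  then have "rel_dvd S z (f * (w + z * c) - z * (f * c))" using f by (intro rel_dvd_diff)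
  then have "rel_dvd S z (f * w)" by (simp add: algebra_simps)
  then show "rel_dvd S z f" using cancelsD[OF assms(1)] f by blast
qed

lemma rel_dvd_to_fract_iff:
  fixes f :: "('n::{finite,linorder}, 'a::idom) ratfun"
  shows "rel_dvd (laurent_ring UNIV rvar) (to_fract P) f \<longleftrightarrow>
    (\<exists>N F. f * (\<Prod>k\<in>UNIV. rvar k) ^ N = to_fract (P * F))"
proof
  assume "rel_dvd (laurent_ring UNIV rvar) (to_fract P) f"
  then obtain h where h: "h \<in> laurent_ring UNIV rvar" "f = to_fract P * h" by (rule rel_dvdE)
  from h(1) obtain N H where "h * (\<Prod>k\<in>UNIV. rvar k) ^ N = to_fract H"
    by (auto elim: laurent_ringE)
  then have "f * (\<Prod>k\<in>UNIV. rvar k) ^ N = to_fract (P * H)" using h by simp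
  then show "\<exists>N F. f * (\<Prod>k\<in>UNIV. rvar k) ^ N = to_fract (P * F)" by blast
next
  assume "\<exists>N F. f * (\<Prod>k\<in>UNIV. rvar k) ^ N = to_fract (P * F)"
  then obtain N F where F: "f * (\<Prod>k\<in>UNIV. rvar k) ^ N = to_fract (P * F)" by blast
  let ?p = "(\<Prod>k\<in>UNIV. rvar k) ^ N :: ('n, 'a) ratfun"
  have p: "?p \<noteq> 0" by simp
  have "to_fract F / ?p \<in> laurent_ring UNIV rvar"
    using p by (intro laurent_ringI[of F _ _ _ N]) auto
  moreover have "f = to_fract P * (to_fract F / ?p)" using F p by (simp add: eq_divide_eq)
  ultimately show "rel_dvd (laurent_ring UNIV rvar) (to_fract P) f" using rel_dvdI by blast
qed

lemma to_fract_prod_mvar: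
  "to_fract ((\<Prod>k\<in>V. mvar k) ^ N) = (\<Prod>k\<in>V. rvar k :: ('n::{finite,linorder}, 'a::idom) ratfun) ^ N"
proof -
  have "to_fract (\<Prod>k\<in>V. mvar k) = (\<Prod>k\<in>V. rvar k :: ('n, 'a) ratfun)"
    by (induction V rule: infinite_finite_induct) (auto simp: rvar_def)
  then show ?thesis by (induction N) auto
qed

text \<open>Clearing the denominators of \<open>f\<close> and of the quotient gives a divisibility
  between polynomials; the monomials introduced are units of the Laurent ring and do no harm
  there.\<close>

lemma cancels_laurent_ring:
  assumes "cancels UNIV P W"
  shows "cancels (laurent_ring UNIV rvar) (to_fract P) (to_fract W)"
  unfolding cancels_def
proof (intro ballI impI)
  let ?p = "\<Prod>k\<in>UNIV. rvar k" and ?m = "\<Prod>k\<in>UNIV. mvar k"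
  fix f assume "f \<in> laurent_ring UNIV rvar"
    and "rel_dvd (laurent_ring UNIV rvar) (to_fract P) (f * to_fract W)"
  then obtain N F M G where F: "f * ?p ^ N = to_fract F" and G: "f * to_fract W * ?p ^ M = to_fract (P * G)"
    unfolding rel_dvd_to_fract_iff by (auto elim!: laurent_ringE)
  have "to_fract (F * ?m ^ M * W) = (f * to_fract W * ?p ^ M) * ?p ^ N"
    by (simp add: F[symmetric] to_fract_prod_mvar[symmetric] ac_simps)
  also have "\<dots> = to_fract (P * (G * ?m ^ N))"
    unfolding G by (simp add: to_fract_prod_mvar[symmetric] ac_simps)
  finally have "F * ?m ^ M * W = P * (G * ?m ^ N)" unfolding to_fract_eq_iff .
  then have "P dvd F * ?m ^ M * W" by simp
  then have "P dvd F * ?m ^ M" using cancelsD[OF assms, of "F * ?m ^ M"] by simp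
  then obtain H where H: "F * ?m ^ M = P * H" by auto
  have "f * ?p ^ (N + M) = to_fract (F * ?m ^ M)"
    using F by (simp add: power_add to_fract_prod_mvar mult.assoc[symmetric])
  then show "rel_dvd (laurent_ring UNIV rvar) (to_fract P) f"
    unfolding H rel_dvd_to_fract_iff by blast
qed

text \<open>In the polynomial ring the clearing monomial is no unit and has to be cancelled, which
  is possible because no variable divides \<open>P\<close>.\<close>

lemma cancels_of_laurent_ring:
  assumes "cancels (laurent_ring UNIV rvar) (to_fract P) (to_fract W)"
    and "\<And>k. \<not> mvar k dvd P"
  shows "cancels UNIV P W"
  unfolding cancels_def rel_dvd_UNIV
proof (intro ballI impI)
  let ?m = "\<Prod>k\<in>UNIV. mvar k"
  interpret U: subring_of "UNIV :: ('a, 'b) mpoly set" by (rule subring_UNIV)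
  have "cancels UNIV P (\<Prod>k\<in>A. mvar k)" for A
  proof (induction A rule: infinite_finite_induct)
    case (insert k A)
    then show ?case using U.cancels_mult cancels_mvar[OF assms(2)] by simp
  qed (simp_all add: cancels_def)
  then have m: "cancels UNIV P (?m ^ N)" for N by (intro U.cancels_power) auto
  fix F assume "P dvd F * W"
  then obtain G where "F * W = P * G" by auto
  then have "to_fract F * to_fract W * (\<Prod>k\<in>UNIV. rvar k) ^ 0 = to_fract (P * G)"
    by (simp flip: to_fract_mult)
  then have "rel_dvd (laurent_ring UNIV rvar) (to_fract P) (to_fract F * to_fract W)"
    unfolding rel_dvd_to_fract_iff by blast
  then have "rel_dvd (laurent_ring UNIV rvar) (to_fract P) (to_fract F)"
    using cancelsD[OF assms(1)] to_fract_in_laurent_ring[of F UNIV] by simp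
  then obtain N H where "to_fract F * (\<Prod>k\<in>UNIV. rvar k) ^ N = to_fract (P * H)"
    unfolding rel_dvd_to_fract_iff by blast
  then have "F * ?m ^ N = P * H" by (simp flip: to_fract_prod_mvar to_fract_mult)
  then have "P dvd F * ?m ^ N" by simp
  then show "P dvd F" using cancelsD[OF m, of F N] by simp
qed

section \<open>Three consecutive exchanges\<close>

lemma rvar_unit:
  "rel_dvd (laurent_ring UNIV rvar) (rvar k powi a) 1"
proof -
  have "1 = rvar k powi a * rvar k powi (- a)" by (simp flip: power_int_add)
  then show ?thesis using rel_dvdI[of "rvar k powi (- a)"] powi_in_laurent_ring[of k UNIV rvar]
    by (metis UNIV_I rvar_nonzero)
qed

text \<open>Clearing denominators in the other variables turns both sides into polynomials, whose
  degrees in x_i are \<open>n\<close> and 0.\<close>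

lemma free_laurent_monomial:
  fixes s t :: "('n::{finite,linorder}, 'a::idom) ratfun"
  assumes "s \<in> laurent_ring (- {i}) rvar" "t \<in> laurent_ring (- {i}) rvar" "s \<noteq> 0"
    "rvar i ^ n * s = t"
  shows "n = 0"
proof -
  interpret subring_of "mpolys (- {i}) :: ('n, 'a) mpoly set" by (rule subring_mpolys)
  let ?p = "\<Prod>k\<in>- {i}. rvar k :: ('n, 'a) ratfun"
  let ?m = "\<Prod>k\<in>- {i}. mvar k :: ('n, 'a) mpoly"
  obtain N S where S: "S \<in> mpolys (- {i})" "s * ?p ^ N = to_fract S"
    using assms(1) by (auto elim: laurent_ringE)
  obtain M T where T: "T \<in> mpolys (- {i})" "t * ?p ^ M = to_fract T"
    using assms(2) by (auto elim: laurent_ringE)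
  have m: "?m ^ N \<in> mpolys (- {i})" "?m ^ M \<in> mpolys (- {i})" for N
    by (intro power_closed prod_mvar_in_mpolys subset_refl)+
  have rv: "rvar i ^ n = (to_fract (mvar i ^ n) :: ('n, 'a) ratfun)"
    by (induction n) (simp_all add: rvar_def)
  have "to_fract (mvar i ^ n * (S * ?m ^ M)) = rvar i ^ n * s * ?p ^ N * ?p ^ M"
    using S by (simp add: rv to_fract_prod_mvar mult.assoc)
  also have "\<dots> = to_fract (T * ?m ^ N)"
    unfolding assms(4) by (simp add: T(2)[symmetric] to_fract_prod_mvar)
  finally have eq: "mvar i ^ n * (S * ?m ^ M) = T * ?m ^ N" unfolding to_fract_eq_iff .
  have "to_fract S \<noteq> 0" unfolding S(2)[symmetric] using assms(3) by simp
  then have S0: "S * ?m ^ M \<noteq> 0" by simp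
  have var: "mpoly_to_poly i (mvar i ^ n) = [:0, 1:] ^ n"
    by (induction n) (simp_all add: mpoly_to_poly_mult mpoly_to_poly_var)
  have "mpoly_to_poly i (S * ?m ^ M) = [:S * ?m ^ M:]" "mpoly_to_poly i (T * ?m ^ N) = [:T * ?m ^ N:]"
    using S(1) T(1) m by (intro mpoly_to_poly_free mult_closed; simp)+
  then have "[:0, 1:] ^ n * [:S * ?m ^ M:] = [:T * ?m ^ N:]"
    using arg_cong[OF eq, of "mpoly_to_poly i"] by (simp only: var mpoly_to_poly_mult[of i "mvar i ^ n"])
  then have "degree ([:0, 1:] ^ n * [:S * ?m ^ M:]) = 0" by simp
  then show "n = 0" using S0 by (subst (asm) degree_mult_eq) (auto simp: degree_power_eq)
qed

text \<open>The polynomials on three consecutive edges labeled \<open>i\<close>, \<open>j\<close>,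
  \<open>i\<close>, detached from the tree and its clusters; \<open>b\<close>, \<open>c\<close> and
  \<open>\<alpha>\<close> come from condition (3).\<close>

locale exchange_triple =
  fixes i j :: "'n::{finite,linorder}"
    and P Q R :: "('n, 'a::{factorial_semiring,idom}) mpoly"
    and b :: nat and c :: 'a and \<alpha> :: "'n \<Rightarrow> int"
  assumes ij: "i \<noteq> j"
    and P_free: "P \<in> mpolys (- {i})" and P_nonzero: "P \<noteq> 0"
    and P_mvar: "\<And>k. \<not> mvar k dvd P"
    and R_free: "R \<in> mpolys (- {i})"
    and coprime_P_Q0: "coprime_elems P (set_zero i Q)"
    and coprime_c_P: "coprime_elems (mconst c) P"
    and exchange_relation: "laurent_monomial c \<alpha> rvar * to_fract (set_zero i Q) ^ b * to_fract P =
      subst_var j (to_fract (set_zero i Q) / rvar j) R"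
begin

abbreviation "L \<equiv> laurent_ring UNIV (rvar :: 'n \<Rightarrow> ('n, 'a) ratfun)"
abbreviation "L' \<equiv> laurent_ring (- {i}) (rvar :: 'n \<Rightarrow> ('n, 'a) ratfun)"

definition "z = to_fract P / rvar i"
definition "u = mpoly_eval rconst (rvar(i := z)) Q / rvar j"
definition "v = mpoly_eval rconst (rvar(i := z, j := u)) R / z"
definition "q = fract_poly (mpoly_to_poly i Q)"
definition "r = fract_poly (mpoly_to_poly j R)"
text \<open>The residue of \<open>u\<close> modulo \<open>z\<close>, which is also the element
  substituted for x_j in condition (3).\<close>

definition "w = to_fract (set_zero i Q) / rvar j"
text \<open>The cofactor of \<open>P\<close> in condition (3), with the power of x_i taken out of
  the monomial so that \<open>B\<close> is free of x_i by construction.\<close>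

definition "B = laurent_monomial c (\<alpha>(i := 0)) rvar * to_fract (set_zero i Q) ^ b"

sublocale L: subring_of L by (rule subring_laurent_ring)
sublocale L': subring_of L' by (rule subring_laurent_ring)

lemma L'_subset: "L' \<subseteq> L"
  by (rule laurent_ring_mono) simp

lemma inverse_rvar: "inverse (rvar k) \<in> L"
  by (rule inverse_in_laurent_ring) auto

lemma inverse_rvar_j: "inverse (rvar j) \<in> L'"
  by (rule inverse_in_laurent_ring) (use ij in auto)

lemma rvar_in: "rvar k \<in> L"
  by (rule var_in_laurent_ring) auto

lemma inverse_rvar_unit: "rel_dvd L (inverse (rvar k)) 1"
  using rvar_unit[of k "-1"] by simp

lemma z_nonzero: "z \<noteq> 0"
  using P_nonzero by (simp add: z_def)

lemma P_eq: "to_fract P = z * rvar i"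
  by (simp add: z_def)

lemma P_in: "to_fract P \<in> L'"
  using P_free by (rule to_fract_in_laurent_ring)

lemma z_in: "z \<in> L"
  using P_in L'_subset inverse_rvar[of i] by (auto simp: z_def divide_inverse)

lemma Q0_free: "set_zero i Q \<in> mpolys (- {i})"
  unfolding set_zero_eq by (rule coeff_mpoly_to_poly)

lemma w_in: "w \<in> L'"
  using to_fract_in_laurent_ring[OF Q0_free] inverse_rvar_j by (simp add: w_def divide_inverse)

lemma q_in: "q \<in> polys_over L'"
  unfolding q_def
  by (rule fract_poly_in_polys_over) (auto simp: polys_over_def coeff_mpoly_to_poly)

lemma r_in: "r \<in> polys_over L'"
  unfolding r_def
proof (rule fract_poly_in_polys_over)
  have "mpoly_to_poly j R \<in> polys_over (mpolys (- {i} - {j}))"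
    by (rule mpoly_to_poly_in_polys_over) (use R_free ij in \<open>simp add: insert_absorb\<close>)
  then show "mpoly_to_poly j R \<in> polys_over (mpolys (- {i}))"
    using mpolys_mono[of "- {i} - {j}" "- {i}"] by (auto simp: polys_over_def)
qed

lemma polys_over_L: "p \<in> polys_over L' \<Longrightarrow> p \<in> polys_over L"
  using L'_subset by (auto simp: polys_over_def)

lemma powi_in: "rvar k powi a \<in> L"
  by (rule powi_in_laurent_ring) auto

lemma laurent_monomial_in:
  assumes "\<beta> i = 0"
  shows "laurent_monomial d \<beta> rvar \<in> L'"
proof -
  have "rvar k powi \<beta> k \<in> L'" for k
    using powi_in_laurent_ring[of k "- {i}" rvar "\<beta> k"] assms by (cases "k = i") auto
  moreover have "rconst d \<in> L'"
    unfolding rconst_def by (rule to_fract_in_laurent_ring) simp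
  ultimately show ?thesis unfolding laurent_monomial_def
    by (intro L'.mult_closed L'.prod_closed) auto
qed

lemma B_in: "B \<in> L'"
  unfolding B_def using to_fract_in_laurent_ring[OF Q0_free] laurent_monomial_in[of "\<alpha>(i := 0)"] by simp

lemma laurent_monomial_split:
  "laurent_monomial d \<beta> (rvar :: 'n \<Rightarrow> ('n, 'a) ratfun) =
    rvar i powi \<beta> i * laurent_monomial d (\<beta>(i := 0)) rvar"
proof -
  have "(\<Prod>k\<in>UNIV. rvar k powi \<beta> k) =
      rvar i powi \<beta> i * (\<Prod>k\<in>UNIV - {i}. rvar k powi \<beta> k :: ('n, 'a) ratfun)"
    by (rule prod.remove) auto
  moreover have "(\<Prod>k\<in>UNIV. rvar k powi (\<beta>(i := 0)) k) =
      rvar i powi (\<beta>(i := 0)) i * (\<Prod>k\<in>UNIV - {i}. rvar k powi (\<beta>(i := 0)) k :: ('n, 'a) ratfun)"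
    by (rule prod.remove) auto
  moreover have "(\<Prod>k\<in>UNIV - {i}. rvar k powi (\<beta>(i := 0)) k) =
      (\<Prod>k\<in>UNIV - {i}. rvar k powi \<beta> k :: ('n, 'a) ratfun)"
    by (rule prod.cong) auto
  ultimately show ?thesis by (simp add: laurent_monomial_def)
qed

lemma poly_r_w: "poly r w = rvar i powi \<alpha> i * B * to_fract P"
  using exchange_relation unfolding laurent_monomial_split[of c \<alpha>] B_def
  by (simp add: subst_var_def eval_rvar_upd r_def w_def mult.assoc)

text \<open>The Laurent monomial of the third condition cannot involve \<open>x\<^sub>i\<close>, because no other factor does.\<close>

lemma poly_r_w_eq: "poly r w = B * to_fract P"
\<comment> \<open>\<open>B\<close> can vanish only when \<open>P\<close> is a unit; then the
  exponent of x_i is undetermined, but the equation is trivial.\<close>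
proof (cases "B = 0")
  case True
  then show ?thesis using poly_r_w by simp
next
  case False
  have BP: "B * to_fract P \<in> L'" "B * to_fract P \<noteq> 0"
    using B_in P_in False P_nonzero by simp_all
  have rw: "poly r w \<in> L'" using r_in w_in by (intro L'.poly_closed) (auto simp: polys_over_def)
  have "\<alpha> i = 0"
  proof (cases "\<alpha> i \<ge> 0")
    case True
    then have "rvar i ^ nat (\<alpha> i) * (B * to_fract P) = poly r w"
      using poly_r_w by (simp add: power_int_def mult.assoc)
    then have "nat (\<alpha> i) = 0" by (rule free_laurent_monomial[OF BP(1) rw BP(2)])
    then show ?thesis using True by simp
  next
    case neg: False
    then have "rvar i ^ nat (- \<alpha> i) * poly r w = B * to_fract P"
      using poly_r_w by (simp add: power_int_def mult.assoc field_simps)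
    moreover from this have "poly r w \<noteq> 0" using BP(2) by auto
    ultimately have "nat (- \<alpha> i) = 0" using free_laurent_monomial[OF rw BP(1)] by blast
    then show ?thesis using neg by simp
  qed
  then show ?thesis using poly_r_w by simp
qed

lemma cancels_Q0: "cancels L (to_fract P) (to_fract (set_zero i Q))"
  by (intro cancels_laurent_ring coprime_elems_cancels P_nonzero coprime_P_Q0)

text \<open>The three factors of \<open>B\<close> are treated separately: the coefficient is coprime
  to \<open>P\<close> by condition (3), the variables are units, and \<open>Q\<close> at x_i = 0 is
  coprime to \<open>P\<close> by condition (2).\<close>

lemma cancels_B: "cancels L (to_fract P) B"
proof -
  have "coprime_elems P (mconst c)" using coprime_c_P by (auto simp: coprime_elems_def)
  then have c: "cancels L (to_fract P) (rconst c)"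
    unfolding rconst_def by (intro cancels_laurent_ring coprime_elems_cancels P_nonzero)
  have powi: "cancels L (to_fract P) (rvar k powi a)" for k a
    by (intro L.cancels_unit rvar_unit powi_in)
  have "cancels L (to_fract P) (\<Prod>k\<in>A. rvar k powi a k) \<and> (\<Prod>k\<in>A. rvar k powi a k) \<in> L" for A a
  proof (induction A rule: infinite_finite_induct)
    case (insert k A)
    then show ?case
      using powi L.cancels_mult powi_in by simp
  qed (simp_all add: cancels_def)
  moreover have "rconst c \<in> L" unfolding rconst_def by (rule to_fract_in_laurent_ring) simp
  ultimately have "cancels L (to_fract P) (laurent_monomial c (\<alpha>(i := 0)) rvar)"
    unfolding laurent_monomial_def using L.cancels_mult[OF c] by blast
  then show ?thesis
    unfolding B_def using laurent_monomial_in[of "\<alpha>(i := 0)"] L'_subset cancels_Q0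
      to_fract_in_laurent_ring[of "set_zero i Q" UNIV]
    by (intro L.cancels_mult L.cancels_power) auto
qed

text \<open>The denominators of \<open>A\<close> and \<open>B\<close> involve only variables other
  than x_i and are units of \<open>L\<close>. Clearing them keeps the coefficients free of x_i, so
  that \<open>cancels_linear\<close> applies; afterwards they are restored.\<close>

lemma cancels_linear_laurent:
  assumes "A \<in> L'"
  shows "cancels L (to_fract P) (A + B * rvar i)"
proof -
  let ?p = "\<Prod>k\<in>- {i}. rvar k :: ('n, 'a) ratfun"
  let ?m = "\<Prod>k\<in>- {i}. mvar k :: ('n, 'a) mpoly"
  interpret M: subring_of "mpolys (- {i}) :: ('n, 'a) mpoly set" by (rule subring_mpolys)
  obtain N F where F: "F \<in> mpolys (- {i})" "A * ?p ^ N = to_fract F"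
    using assms by (auto elim: laurent_ringE)
  obtain M G where G: "G \<in> mpolys (- {i})" "B * ?p ^ M = to_fract G"
    using B_in by (auto elim: laurent_ringE)
  have m: "?m ^ N \<in> mpolys (- {i})" for N
    by (intro M.power_closed prod_mvar_in_mpolys) simp
  have p: "?p ^ n \<in> L" for n using rvar_in by (intro L.power_closed L.prod_closed)
  have p_inv: "inverse (?p ^ n) \<in> L" for n
    using inverse_rvar
    by (simp add: power_inverse[symmetric] prod_inversef[symmetric] comp_def L.prod_closed)
  have p_unit: "rel_dvd L (?p ^ n) 1" for n
    using rel_dvdI[OF p_inv[of n], of "?p ^ n"] by simp
  have p_inv_unit: "rel_dvd L (inverse (?p ^ n)) 1" for n
    using rel_dvdI[OF p[of n], of "inverse (?p ^ n)"] by simp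
  have "cancels L (to_fract P) (B * ?p ^ (N + M))"
    using B_in L'_subset p p_unit by (intro L.cancels_mult cancels_B L.cancels_unit) auto
  also have "B * ?p ^ (N + M) = to_fract (G * ?m ^ N)"
    using G by (simp add: power_add to_fract_prod_mvar ac_simps)
  finally have "cancels UNIV P (G * ?m ^ N)" using P_mvar by (rule cancels_of_laurent_ring)
  then have "cancels UNIV P (F * ?m ^ M + G * ?m ^ N * mvar i)"
    using F G m P_free by (intro cancels_linear) simp_all
  then have "cancels L (to_fract P) (to_fract (F * ?m ^ M + G * ?m ^ N * mvar i))"
    by (rule cancels_laurent_ring)
  also have "to_fract (F * ?m ^ M + G * ?m ^ N * mvar i) = (A + B * rvar i) * ?p ^ (N + M)"
    by (simp add: F(2)[symmetric] G(2)[symmetric] to_fract_prod_mvar power_add rvar_def algebra_simps)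
  finally have canc: "cancels L (to_fract P) ((A + B * rvar i) * ?p ^ (N + M))" .
  have "A + B * rvar i \<in> L"
    using assms B_in L'_subset rvar_in[of i] by (meson L.add_closed L.mult_closed subsetD)
  then have "cancels L (to_fract P) ((A + B * rvar i) * ?p ^ (N + M) * inverse (?p ^ (N + M)))"
    by (rule L.cancels_mult[OF canc L.cancels_unit[OF p_inv p_inv_unit] L.mult_closed[OF _ p]])
  then show ?thesis by (simp add: mult.assoc)
qed

text \<open>
  Second-order Taylor expansions of \<open>Q\<close> at \<open>x\<^sub>i = 0\<close> and of \<open>R\<close> at \<open>x\<^sub>j = w\<close>: modulo \<open>z\<close>,
  \<open>v\<close> is linear in \<open>x\<^sub>i\<close>, with leading coefficient \<open>B\<close>.
\<close>

lemma expansions: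
  "\<exists>C\<in>L. u = w + z * C"
  "\<exists>A\<in>L'. \<exists>C\<in>L. v = A + B * rvar i + z * C"
proof -
  define q1 where "q1 = poly (pderiv q) 0"
  obtain C where C: "C \<in> L" "poly q (0 + z) = poly q 0 + z * q1 + z\<^sup>2 * C"
    using L.poly_taylor(1)[OF polys_over_L[OF q_in] L.zero_closed z_in] unfolding q1_def by blast
  have q1: "q1 \<in> L'" unfolding q1_def by (rule L'.poly_taylor(2)[OF q_in, where s = 0]) auto
  have q0: "poly q 0 = to_fract (set_zero i Q)"
    by (simp add: q_def poly_0_coeff_0 coeff_map_poly set_zero_eq)
  \<comment> \<open>The quotient of \<open>u - w\<close> by \<open>z\<close>; its residue modulo
    \<open>z\<close> is \<open>q1 / x_j\<close>, free of x_i.\<close>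
  define h where "h = (q1 + z * C) * inverse (rvar j)"
  have h: "h \<in> L" unfolding h_def using q1 L'_subset z_in C inverse_rvar by auto
  have u: "u = w + z * h"
    using C(2) unfolding u_def eval_rvar_upd q_def[symmetric] w_def h_def
    by (simp add: q0 field_simps power2_eq_square)
  then show "\<exists>C\<in>L. u = w + z * C" using h by blast
  define D where "D = poly (pderiv r) w"
  have D: "D \<in> L'" unfolding D_def by (rule L'.poly_taylor(2)[OF r_in w_in, where s = 0]) simp
  have wL: "w \<in> L" using w_in L'_subset by auto
  obtain C' where C': "C' \<in> L" "poly r (w + z * h) = poly r w + z * h * D + (z * h)\<^sup>2 * C'"
    using L.poly_taylor(1)[OF polys_over_L[OF r_in] wL L.mult_closed[OF z_in h]] unfolding D_def
    by blast
  \<comment> \<open>\<open>R\<close> does not contain x_i, so \<open>z\<close> enters the numerator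
    of \<open>v\<close> only through \<open>u\<close>.\<close>
  have "mpoly_eval rconst (rvar(i := z, j := u)) R = mpoly_eval rconst (rvar(j := u)) R"
    by (rule rconst.eval_cong[OF R_free]) auto
  then have "v = poly r (w + z * h) / z"
    unfolding v_def by (simp add: eval_rvar_upd r_def u)
  \<comment> \<open>Here condition (3) acts: \<open>poly r w\<close> is \<open>B * z * x_i\<close>,
    so this term too is divisible by \<open>z\<close>.\<close>
  also have "\<dots> = B * rvar i + h * D + z * (h\<^sup>2 * C')"
    using z_nonzero unfolding C' poly_r_w_eq P_eq by (simp add: field_simps power2_eq_square)
  \<comment> \<open>Replacing \<open>h\<close> by its residue separates the part free of x_i, namely
    \<open>A = q1 * D / x_j\<close>, from the multiples of \<open>z\<close>.\<close>
  also have "\<dots> = q1 * inverse (rvar j) * D + B * rvar i + z * (C * inverse (rvar j) * D + h\<^sup>2 * C')"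
    unfolding h_def by (simp add: algebra_simps)
  finally have "v = q1 * inverse (rvar j) * D + B * rvar i + z * (C * inverse (rvar j) * D + h\<^sup>2 * C')" .
  moreover have "q1 * inverse (rvar j) * D \<in> L'" using q1 D inverse_rvar_j by simp
  moreover have "C * inverse (rvar j) * D + h\<^sup>2 * C' \<in> L"
    using C C' h D L'_subset inverse_rvar by (auto simp: power2_eq_square)
  ultimately show "\<exists>A\<in>L'. \<exists>C\<in>L. v = A + B * rvar i + z * C" by blast
qed

lemma u_in: "u \<in> L"
  using expansions(1) w_in L'_subset z_in by auto

lemma v_in: "v \<in> L"
proof -
  obtain A C where "A \<in> L" "C \<in> L" "v = A + B * rvar i + z * C"
    using expansions(2) L'_subset by blast
  moreover have "B \<in> L" using B_in L'_subset by blast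
  ultimately show ?thesis using z_in rvar_in by simp
qed

text \<open>\<open>z\<close> is \<open>P\<close> up to the unit x_i, and adding a multiple of
  \<open>z\<close> does not affect cancellation against \<open>z\<close>.\<close>

lemma cancels_z: "cancels L z (a + z * C)" if "cancels L (to_fract P) a" "C \<in> L"
proof -
  have "cancels L z a"
    unfolding z_def divide_inverse
    using that inverse_rvar inverse_rvar_unit by (intro L.cancels_unit_left)
  then show ?thesis using that by (intro L.cancels_add_multiple)
qed

lemma cancels_z_u: "cancels L z u"
proof -
  have "cancels L (to_fract P) w"
    unfolding w_def divide_inverse
    using to_fract_in_laurent_ring[of "set_zero i Q" UNIV] inverse_rvar inverse_rvar_unit
    by (intro L.cancels_mult cancels_Q0 L.cancels_unit) auto
  then show ?thesis using expansions(1) cancels_z by auto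
qed

lemma cancels_z_v: "cancels L z v"
  using expansions(2) cancels_linear_laurent cancels_z by auto

lemma cancels_z_u_v: "cancels L (z ^ n) ((u * v) ^ k)"
  using cancels_z_u cancels_z_v u_in v_in z_in z_nonzero
  by (intro L.cancels_power L.cancels_power_left L.cancels_mult) auto

end

section \<open>Laurent polynomials under a change of cluster\<close>

lemma eval_in_laurent_ring_of_clusters:
  fixes F :: "('n::{finite,linorder}, 'a::idom) mpoly"
  assumes "\<And>k. y' k \<in> laurent_ring V y"
  shows "mpoly_eval rconst y' F \<in> laurent_ring V y"
proof -
  interpret subring_of "laurent_ring V y" by (rule subring_laurent_ring)
  show ?thesis
  proof (induction F rule: mpoly_induct)
    case (const c)
    have "rconst c = mpoly_eval rconst y (mconst c)" by (rule rconst.eval_const[symmetric])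
    then show ?case unfolding rconst.eval_const using eval_in_laurent_ring[of "mconst c" V y] by simp
  qed (use assms in \<open>simp_all add: rconst.eval_add rconst.eval_mult\<close>)
qed

text \<open>\<open>e\<close> is meant to be the inverse of the product of the unchanged variables;
  then \<open>d\<close> is the product of the new ones, and only its powers remain as
  denominators.\<close>

lemma laurent_ring_clear:
  assumes y': "\<And>k. y' k \<in> laurent_ring UNIV y" and X: "X \<in> laurent_ring UNIV y'"
    and prod: "(\<Prod>k\<in>UNIV. y' k) * e = d" and e: "e \<in> laurent_ring UNIV y"
  shows "\<exists>N. X * d ^ N \<in> laurent_ring UNIV y"
proof -
  interpret subring_of "laurent_ring UNIV y" by (rule subring_laurent_ring)
  from X obtain N F where F: "X * (\<Prod>k\<in>UNIV. y' k) ^ N = mpoly_eval rconst y' F"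
    by (rule laurent_ringE)
  have "mpoly_eval rconst y' F \<in> laurent_ring UNIV y"
    by (rule eval_in_laurent_ring_of_clusters[OF y'])
  then have "X * (\<Prod>k\<in>UNIV. y' k) ^ N * e ^ N \<in> laurent_ring UNIV y" using F e by simp
  then have "X * d ^ N \<in> laurent_ring UNIV y"
    by (simp add: prod[symmetric] power_mult_distrib mult.assoc)
  then show ?thesis ..
qed

lemma prod_upd:
  fixes y :: "'n::finite \<Rightarrow> 'k::field"
  assumes "y i \<noteq> 0"
  shows "(\<Prod>k\<in>UNIV. (y(i := z)) k) = (\<Prod>k\<in>UNIV. y k) * inverse (y i) * z"
proof -
  have "(\<Prod>k\<in>UNIV. (y(i := z)) k) = z * (\<Prod>k\<in>UNIV - {i}. y k)"
    by (subst prod.remove[of _ i]) (auto intro!: prod.cong)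
  moreover have "(\<Prod>k\<in>UNIV. y k) = y i * (\<Prod>k\<in>UNIV - {i}. y k)"
    by (rule prod.remove) auto
  ultimately show ?thesis using assms by simp
qed

context exchange_triple
begin

text \<open>Pulling back along the substitution of \<open>y\<close> turns \<open>z'\<close>,
  \<open>u'\<close>, \<open>v'\<close> into the fixed elements \<open>z\<close>, \<open>u\<close>,
  \<open>v\<close>, whose coprimality in \<open>L\<close> is already known.\<close>

theorem laurent_ring_inter:
  assumes y: "alg_indep y"
    and z': "y i * z' = mpoly_eval rconst y P"
    and u': "y j * u' = mpoly_eval rconst (y(i := z')) Q"
    and v': "z' * v' = mpoly_eval rconst (y(i := z', j := u')) R"
    and X1: "X \<in> laurent_ring UNIV (y(i := z'))"
    and X3: "X \<in> laurent_ring UNIV (y(i := v', j := u'))"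
  shows "X \<in> laurent_ring UNIV y"
proof -
  interpret Y: subring_of "laurent_ring UNIV y" by (rule subring_laurent_ring)
  let ?\<theta> = "fract_subst y"
  have y0: "y k \<noteq> 0" for k by (rule alg_indep_nonzero[OF y])
  have z'_eq: "z' = ?\<theta> z"
    using z' y0[of i] by (simp add: z_def fract_subst_divide[OF y] fract_subst_to_fract[OF y]
        fract_subst_rvar[OF y] eq_divide_eq mult.commute)
  have upd1: "(\<lambda>k. ?\<theta> ((rvar(i := z)) k)) = y(i := z')"
    using z'_eq fract_subst_rvar[OF y] by auto
  have u'_eq: "u' = ?\<theta> u"
    using u' y0[of j] by (simp add: u_def fract_subst_divide[OF y] fract_subst_eval[OF y] upd1
        fract_subst_rvar[OF y] eq_divide_eq mult.commute del: fun_upd_apply)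
  have upd2: "(\<lambda>k. ?\<theta> ((rvar(i := z, j := u)) k)) = y(i := z', j := u')"
    using z'_eq u'_eq fract_subst_rvar[OF y] by auto
  have z'0: "z' \<noteq> 0" using z'_eq z_nonzero fract_subst_eq_0_iff[OF y] by simp
  have v'_eq: "v' = ?\<theta> v"
    using v' z'0 by (simp add: v_def fract_subst_divide[OF y] fract_subst_eval[OF y] upd2
        z'_eq[symmetric] eq_divide_eq mult.commute del: fun_upd_apply)
  have LY: "f \<in> L \<Longrightarrow> ?\<theta> f \<in> laurent_ring UNIV y" for f
    using laurent_ring_eq_image[OF y, of UNIV] by simp
  have zuv: "z' \<in> laurent_ring UNIV y" "u' \<in> laurent_ring UNIV y" "v' \<in> laurent_ring UNIV y"
    using LY z_in u_in v_in by (simp_all add: z'_eq u'_eq v'_eq)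
  have inv: "inverse (y k) \<in> laurent_ring UNIV y" for k
    by (rule inverse_in_laurent_ring) (use y0 in auto)
  have var: "y k \<in> laurent_ring UNIV y" for k by (rule var_in_laurent_ring) auto
  \<comment> \<open>The inverse of the product of all \<open>y k\<close> with
    \<open>k \<noteq> i\<close>; likewise \<open>e * y j\<close> omits both \<open>i\<close> and
    \<open>j\<close>.\<close>
  define e where "e = y i * (\<Prod>k\<in>UNIV. inverse (y k))"
  have e: "e \<in> laurent_ring UNIV y" "e * y j \<in> laurent_ring UNIV y"
    unfolding e_def using var inv by (auto intro!: Y.mult_closed Y.prod_closed)
  have p: "(\<Prod>k\<in>UNIV. y k) * e = y i" unfolding e_def using y0 by (simp add: prod.distrib[symmetric])
  have p': "e * (inverse (y i) * (\<Prod>k\<in>UNIV. y k)) = 1"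
  proof -
    have "e * (inverse (y i) * (\<Prod>k\<in>UNIV. y k)) = (\<Prod>k\<in>UNIV. y k) * e * inverse (y i)"
      by (simp only: ac_simps)
    then show ?thesis using p y0[of i] by simp
  qed
  have p1: "(\<Prod>k\<in>UNIV. (y(i := z')) k) * e = z'"
    unfolding prod_upd[OF y0] using p' by (simp add: ac_simps)
  have yj: "(y(i := v')) j \<noteq> 0" "(y(i := v')) j = y j" using ij y0 by simp_all
  have "(\<Prod>k\<in>UNIV. (y(i := v', j := u')) k) * (e * y j) =
      e * (inverse (y i) * (\<Prod>k\<in>UNIV. y k)) * (inverse (y j) * y j) * (u' * v')"
    unfolding prod_upd[of "y(i := v')" j, OF yj(1)] prod_upd[OF y0] yj(2) by (simp only: ac_simps)
  then have p3: "(\<Prod>k\<in>UNIV. (y(i := v', j := u')) k) * (e * y j) = u' * v'"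
    using p' y0[of j] by simp
  have y1: "(y(i := z')) k \<in> laurent_ring UNIV y"
    and y3: "(y(i := v', j := u')) k \<in> laurent_ring UNIV y" for k
    using zuv var by simp_all
  obtain a where "X * z' ^ a \<in> laurent_ring UNIV y"
    using laurent_ring_clear[OF y1 X1 p1 e(1)] by blast
  then obtain f where f: "f \<in> L" "X * z' ^ a = ?\<theta> f"
    unfolding laurent_ring_eq_image[OF y, of UNIV] by blast
  obtain d where "X * (u' * v') ^ d \<in> laurent_ring UNIV y"
    using laurent_ring_clear[OF y3 X3 p3 e(2)] by blast
  then obtain g where g: "g \<in> L" "X * (u' * v') ^ d = ?\<theta> g"
    unfolding laurent_ring_eq_image[OF y, of UNIV] by blast
  have "?\<theta> (f * (u * v) ^ d) = (X * z' ^ a) * (u' * v') ^ d"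
    unfolding f by (simp add: fract_subst_mult[OF y] fract_subst_power[OF y] u'_eq v'_eq)
  also have "\<dots> = z' ^ a * (X * (u' * v') ^ d)" by (simp only: ac_simps)
  also have "\<dots> = ?\<theta> (z ^ a * g)"
    unfolding g by (simp add: fract_subst_mult[OF y] fract_subst_power[OF y] z'_eq)
  finally have "f * (u * v) ^ d = z ^ a * g" unfolding fract_subst_eq_iff[OF y] .
  then have "rel_dvd L (z ^ a) (f * (u * v) ^ d)" using rel_dvdI[OF g(1)] by simp
  then have "rel_dvd L (z ^ a) f" using cancelsD[OF cancels_z_u_v] f by blast
  then obtain k where k: "k \<in> L" "f = z ^ a * k" by (rule rel_dvdE)
  then have "X * z' ^ a = ?\<theta> k * z' ^ a"
    using f by (simp add: fract_subst_mult[OF y] fract_subst_power[OF y] z'_eq)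
  then have "X = ?\<theta> k" using z'0 by simp
  then show ?thesis using LY k by simp
qed

end

section \<open>Induction along the spine\<close>

text \<open>Dividing by the common denominator shifts every exponent of \<open>F\<close> down by
  \<open>N\<close>. The shift is injective, so the coefficients can be indexed by the shifted
  exponents.\<close>

lemma laurent_polynomial_in_of_laurent_ring:
  fixes y :: "'n::{finite,linorder} \<Rightarrow> ('n, 'a::idom) ratfun"
  assumes y: "\<And>k. y k \<noteq> 0" and f: "f \<in> laurent_ring UNIV y"
  shows "laurent_polynomial_in y f"
proof -
  from f obtain N F where F: "f * (\<Prod>k\<in>UNIV. y k) ^ N = mpoly_eval rconst y F"
    by (rule laurent_ringE)
  define shift where "shift = (\<lambda>(e :: 'n \<Rightarrow>\<^sub>0 nat) k. int (Poly_Mapping.lookup e k) - int N)"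
  have inj: "inj_on shift (Poly_Mapping.keys F)"
    by (auto simp: inj_on_def shift_def fun_eq_iff intro!: poly_mapping_eqI)
  define c where "c = (\<lambda>\<beta>. Poly_Mapping.lookup F (inv_into (Poly_Mapping.keys F) shift \<beta>))"
  have p: "(\<Prod>k\<in>UNIV. y k) ^ N \<noteq> 0" using y by simp
  have "f = mpoly_eval rconst y F / (\<Prod>k\<in>UNIV. y k) ^ N"
    using F p by (simp add: eq_divide_eq)
  also have "\<dots> = (\<Sum>e\<in>Poly_Mapping.keys F. laurent_monomial (Poly_Mapping.lookup F e) (shift e) y)"
    unfolding mpoly_eval_def sum_divide_distrib laurent_monomial_def
  proof (intro sum.cong refl)
    fix e
    have "(\<Prod>k\<in>UNIV. y k powi shift e k) = (\<Prod>k\<in>UNIV. y k ^ Poly_Mapping.lookup e k / y k ^ N)"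
      unfolding shift_def using y by (intro prod.cong) (auto simp: power_int_diff)
    then show "rconst (Poly_Mapping.lookup F e) * (\<Prod>k\<in>UNIV. y k ^ Poly_Mapping.lookup e k) /
        (\<Prod>k\<in>UNIV. y k) ^ N = rconst (Poly_Mapping.lookup F e) * (\<Prod>k\<in>UNIV. y k powi shift e k)"
      by (simp add: prod_dividef prod_power_distrib)
  qed
  also have "\<dots> = (\<Sum>e\<in>Poly_Mapping.keys F. laurent_monomial (c (shift e)) (shift e) y)"
    using inj by (intro sum.cong) (auto simp: c_def)
  also have "\<dots> = (\<Sum>\<beta>\<in>shift ` Poly_Mapping.keys F. laurent_monomial (c \<beta>) \<beta> y)"
    using inj by (simp add: sum.reindex)
  finally show ?thesis unfolding laurent_polynomial_in_def
    by (intro exI[of _ "shift ` Poly_Mapping.keys F"] exI[of _ c]) simp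
qed

lemma tree_edge_at_spine:
  assumes "e \<in> tree_edges n m" "Spine s \<in> e"
  obtains t where "e = {t, Spine s}"
  using assms by (auto simp: tree_edges_def spine_arc_def insert_commute)

locale exchange_pattern =
  fixes m :: nat
    and label :: "vertex set \<Rightarrow> 'n::{finite,linorder}"
    and pol :: "vertex set \<Rightarrow> ('n, 'a::{factorial_semiring,idom}) mpoly"
    and x :: "vertex \<Rightarrow> 'n \<Rightarrow> ('n, 'a) ratfun"
  assumes n_ge_2: "CARD('n) \<ge> 2"
    and m_ge_1: "m \<ge> 1"
    and label_distinct:
      "\<And>s. s \<in> {1..m} \<Longrightarrow> inj_on label {e \<in> tree_edges CARD('n) m. Spine s \<in> e}"
    and pol_nonzero: "\<And>e. e \<in> tree_edges CARD('n) m \<Longrightarrow> pol e \<noteq> 0"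
    and initial_cluster: "\<And>i. x Tail i = rvar i"
    and exchange_fixed:
      "\<And>t t' i. {t, t'} \<in> tree_edges CARD('n) m \<Longrightarrow> i \<noteq> label {t, t'} \<Longrightarrow> x t i = x t' i"
    and exchange:
      "\<And>t t' k. {t, t'} \<in> tree_edges CARD('n) m \<Longrightarrow> k = label {t, t'} \<Longrightarrow>
         x t k * x t' k = mpoly_eval rconst (x t) (pol {t, t'})"
    and cond1:
      "\<And>e. e \<in> tree_edges CARD('n) m \<Longrightarrow>
         \<not> depends_on (pol e) (label e) \<and> (\<forall>i. \<not> mvar i dvd pol e)"
    and cond2:
      "\<And>t t' t'' i. {t, t'} \<in> tree_edges CARD('n) m \<Longrightarrow> spine_arc m t' t'' \<Longrightarrow> t \<noteq> t'' \<Longrightarrow>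
         i = label {t, t'} \<Longrightarrow>
         coprime_elems (pol {t, t'}) (set_zero i (pol {t', t''}))"
    and cond3:
      "\<And>t t' t'' t''' i j P Q0 R.
         {t, t'} \<in> tree_edges CARD('n) m \<Longrightarrow> spine_arc m t' t'' \<Longrightarrow>
         {t'', t'''} \<in> tree_edges CARD('n) m \<Longrightarrow>
         distinct [{t, t'}, {t', t''}, {t'', t'''}] \<Longrightarrow>
         label {t, t'} = i \<Longrightarrow> label {t', t''} = j \<Longrightarrow> label {t'', t'''} = i \<Longrightarrow>
         P = pol {t, t'} \<Longrightarrow> Q0 = set_zero i (pol {t', t''}) \<Longrightarrow> R = pol {t'', t'''} \<Longrightarrow>
         \<exists>(b::nat) c \<alpha>. coprime_elems (mconst c) P \<and>
           laurent_monomial c \<alpha> rvar * to_fract Q0 ^ b * to_fract P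
             = subst_var j (to_fract Q0 / rvar j) R"
begin

section \<open>Clusters on the tree\<close>

definition edge :: "vertex \<Rightarrow> vertex \<Rightarrow> bool" where
  "edge t t' \<longleftrightarrow> {t, t'} \<in> tree_edges CARD('n) m"

lemma edge_sym: "edge t t' \<Longrightarrow> edge t' t"
  by (simp add: edge_def insert_commute)

lemma cluster_upd:
  assumes "edge t t'"
  shows "x t' = (x t)(label {t, t'} := x t' (label {t, t'}))"
  using exchange_fixed[of t t'] assms by (auto simp: edge_def fun_eq_iff)

lemma pol_free: "edge t t' \<Longrightarrow> pol {t, t'} \<in> mpolys (- {label {t, t'}})"
  using cond1[of "{t, t'}"] by (simp add: edge_def not_depends_on_iff)

lemma exchange_edge:
  "edge t t' \<Longrightarrow> x t (label {t, t'}) * x t' (label {t, t'}) = mpoly_eval rconst (x t) (pol {t, t'})"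
  using exchange by (simp add: edge_def)

text \<open>Propagated from the initial cluster, this allows any cluster to play the part of the
  initial one.\<close>

lemma indep_edge:
  assumes "edge t t'" "alg_indep (x t)"
  shows "alg_indep (x t')"
  using alg_indep_mutation[OF assms(2) pol_free[OF assms(1)] _ exchange_edge[OF assms(1)]]
    assms pol_nonzero cluster_upd[OF assms(1)] by (simp add: edge_def)

lemma edge_Tail: "edge Tail (Spine 1)"
  by (simp add: edge_def tree_edges_def)

lemma spine_arcI: "1 \<le> s \<Longrightarrow> s < m \<Longrightarrow> spine_arc m (Spine s) (Spine (Suc s))"
  by (simp add: spine_arc_def)

lemma edge_spine: "1 \<le> s \<Longrightarrow> s < m \<Longrightarrow> edge (Spine s) (Spine (Suc s))"
  using spine_arcI unfolding edge_def tree_edges_def by blast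

lemma indep_spine: "1 \<le> s \<Longrightarrow> s \<le> m \<Longrightarrow> alg_indep (x (Spine s))"
proof (induction s rule: dec_induct)
  case base
  have "x Tail = rvar" using initial_cluster by auto
  then show ?case using indep_edge[OF edge_Tail] alg_indep_rvar by simp
next
  case (step s)
  then show ?case using indep_edge[OF edge_spine[of s]] by simp
qed

lemma indep_at_spine: "edge t (Spine s) \<Longrightarrow> 1 \<le> s \<Longrightarrow> s \<le> m \<Longrightarrow> alg_indep (x t)"
  using indep_edge edge_sym indep_spine by blast

text \<open>A spine vertex has as many edges as there are labels, and their labels are distinct, so
  every label occurs. This supplies the second edge labeled \<open>i\<close> of the path.\<close>

lemma edge_label_exists:
  assumes "1 \<le> s" "s \<le> m"
  shows "\<exists>t. edge t (Spine s) \<and> label {t, Spine s} = i"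
proof -
  let ?E = "{e \<in> tree_edges CARD('n) m. Spine s \<in> e}"
  have "card (label ` ?E) = CARD('n)"
    using degree_spine[OF n_ge_2, of s m] card_image[OF label_distinct[of s]] assms by simp
  then have "label ` ?E = UNIV" by (intro card_subset_eq) auto
  then have "i \<in> label ` ?E" by blast
  then obtain e where e: "e \<in> ?E" "label e = i" by blast
  then obtain t where "e = {t, Spine s}" using tree_edge_at_spine[of e "CARD('n)" m s] by blast
  then show ?thesis using e by (auto simp: edge_def)
qed

lemma edge_label_inj:
  assumes "edge t (Spine s)" "edge t' (Spine s)" "1 \<le> s" "s \<le> m"
    "label {t, Spine s} = label {t', Spine s}"
  shows "t = t'"
proof -
  have "{t, Spine s} = {t', Spine s}"
    using inj_onD[OF label_distinct[of s] assms(5)] assms by (simp add: edge_def)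
  then show ?thesis by (auto simp: doubleton_eq_iff)
qed

lemma laurent_ring_edge:
  assumes "edge t t'" "alg_indep (x t)"
  shows "x t' k \<in> laurent_ring UNIV (x t)"
proof (cases "k = label {t, t'}")
  case True
  interpret subring_of "laurent_ring UNIV (x t)" by (rule subring_laurent_ring)
  have nz: "x t k \<noteq> 0" by (rule alg_indep_nonzero[OF assms(2)])
  then have "x t' k = mpoly_eval rconst (x t) (pol {t, t'}) * inverse (x t k)"
    using exchange_edge[OF assms(1)] True by (simp add: field_simps)
  then show ?thesis
    using eval_in_laurent_ring[of "pol {t, t'}" UNIV "x t"] inverse_in_laurent_ring[of k UNIV "x t"] nz
    by simp
next
  case False
  then have "x t' k = x t k" using exchange_fixed[of t t' k] assms(1) by (simp add: edge_def)
  then show ?thesis using var_in_laurent_ring[of k UNIV "x t"] by simp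
qed

text \<open>The two edges carry different labels, so the variable exchanged on the second edge is
  still a variable of the cluster at \<open>t\<close>, and dividing by it is harmless.\<close>

lemma laurent_ring_two_edges:
  assumes "edge t (Spine s)" "edge t' (Spine s)" "1 \<le> s" "s \<le> m"
  shows "x t' k \<in> laurent_ring UNIV (x t)"
proof (cases "t = t'")
  case True
  then show ?thesis using var_in_laurent_ring[of k UNIV "x t"] by simp
next
  case False
  interpret subring_of "laurent_ring UNIV (x t)" by (rule subring_laurent_ring)
  have indep: "alg_indep (x t)" using indep_at_spine assms by blast
  note spine = laurent_ring_edge[OF assms(1) indep]
  let ?l = "label {t', Spine s}"
  have l: "?l \<noteq> label {t, Spine s}" using edge_label_inj assms False by metis
  have l_eq: "x (Spine s) ?l = x t ?l"
    using exchange_fixed[of t "Spine s" ?l] assms(1) l by (simp add: edge_def)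
  show ?thesis
  proof (cases "k = ?l")
    case True
    have nz: "x t k \<noteq> 0" by (rule alg_indep_nonzero[OF indep])
    have "x t k * x t' k = mpoly_eval rconst (x (Spine s)) (pol {Spine s, t'})"
      using exchange_edge[OF edge_sym[OF assms(2)]] l_eq True by (simp add: insert_commute)
    then have "x t' k = mpoly_eval rconst (x (Spine s)) (pol {Spine s, t'}) * inverse (x t k)"
      using nz by (simp add: field_simps)
    then show ?thesis
      using eval_in_laurent_ring_of_clusters[OF spine, where F = "pol {Spine s, t'}"]
        inverse_in_laurent_ring[of k UNIV "x t"] nz
      by simp
  next
    case False
    then have "x t' k = x (Spine s) k"
      using exchange_fixed[of t' "Spine s" k] assms(2) by (simp add: edge_def)
    then show ?thesis using spine by simp
  qed
qed

text \<open>The assumption \<open>t \<noteq> Spine (Suc s)\<close> excludes going back along the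
  spine edge, as conditions (2) and (3) demand.\<close>

lemma laurent_ring_intersection:
  assumes "1 \<le> s" "s < m" "edge t (Spine s)" "t \<noteq> Spine (Suc s)"
    "edge t3 (Spine (Suc s))" "label {t3, Spine (Suc s)} = label {t, Spine s}"
    "X \<in> laurent_ring UNIV (x (Spine s))" "X \<in> laurent_ring UNIV (x t3)"
  shows "X \<in> laurent_ring UNIV (x t)"
proof -
  define i where "i = label {t, Spine s}"
  define j where "j = label {Spine s, Spine (Suc s)}"
  define P where "P = pol {t, Spine s}"
  define Q where "Q = pol {Spine s, Spine (Suc s)}"
  define R where "R = pol {Spine (Suc s), t3}"
  have arc: "spine_arc m (Spine s) (Spine (Suc s))" using assms by (intro spine_arcI)
  have e12: "edge (Spine s) (Spine (Suc s))" using assms by (intro edge_spine)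
  have e23: "edge (Spine (Suc s)) t3" using assms edge_sym by blast
  have l23: "label {Spine (Suc s), t3} = i" using assms by (simp add: i_def insert_commute)
  have ij: "i \<noteq> j"
    using edge_label_inj[OF assms(3) edge_sym[OF e12]] assms by (auto simp: i_def j_def insert_commute)
  \<comment> \<open>Otherwise the last edge would be the spine edge itself, whose label is
    \<open>j\<close>.\<close>
  have t3: "t3 \<noteq> Spine s" using ij l23 by (auto simp: j_def insert_commute)
  have dist: "distinct [{t, Spine s}, {Spine s, Spine (Suc s)}, {Spine (Suc s), t3}]"
    using assms(4) t3 by (auto simp: doubleton_eq_iff)
  obtain b c \<alpha> where c: "coprime_elems (mconst c) P"
    "laurent_monomial c \<alpha> rvar * to_fract (set_zero i Q) ^ b * to_fract P =
      subst_var j (to_fract (set_zero i Q) / rvar j) R"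
    using cond3[OF _ arc _ dist i_def[symmetric] j_def[symmetric] l23 P_def _ R_def, of "set_zero i Q"]
      assms(3) e23 by (auto simp: edge_def Q_def)
  have "exchange_triple i j P Q R b c \<alpha>"
  proof
    show "i \<noteq> j" by (rule ij)
    show "P \<in> mpolys (- {i})" unfolding P_def i_def by (rule pol_free[OF assms(3)])
    show "P \<noteq> 0" using pol_nonzero assms(3) by (simp add: P_def edge_def)
    show "\<not> mvar k dvd P" for k using cond1 assms(3) by (simp add: P_def edge_def)
    show "R \<in> mpolys (- {i})" using pol_free[OF e23] l23 by (simp add: R_def)
    show "coprime_elems P (set_zero i Q)"
      using cond2[OF _ arc assms(4) i_def] assms(3) by (simp add: P_def Q_def edge_def)
  qed (rule c)+
  then interpret exchange_triple i j P Q R b c \<alpha> .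
  have x1: "x (Spine s) = (x t)(i := x (Spine s) i)"
    using cluster_upd[OF assms(3)] by (simp add: i_def)
  have x2: "x (Spine (Suc s)) = (x t)(i := x (Spine s) i, j := x (Spine (Suc s)) j)"
    using cluster_upd[OF e12] x1 by (metis j_def)
  have "x t3 = (x (Spine (Suc s)))(i := x t3 i)"
    using cluster_upd[OF e23] unfolding l23 .
  also have "\<dots> = ((x t)(i := x (Spine s) i, j := x (Spine (Suc s)) j))(i := x t3 i)"
    by (rule arg_cong[OF x2])
  also have "\<dots> = (x t)(i := x t3 i, j := x (Spine (Suc s)) j)"
    using ij by (simp add: fun_upd_twist)
  finally have x3: "x t3 = (x t)(i := x t3 i, j := x (Spine (Suc s)) j)" .
  show ?thesis
  proof (rule laurent_ring_inter)
    show "alg_indep (x t)" using indep_at_spine assms by simp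
    show "x t i * x (Spine s) i = mpoly_eval rconst (x t) P"
      using exchange_edge[OF assms(3)] by (simp add: i_def P_def)
    have "x (Spine s) j = x t j" using x1 ij by (metis fun_upd_other)
    then show "x t j * x (Spine (Suc s)) j = mpoly_eval rconst ((x t)(i := x (Spine s) i)) Q"
      using exchange_edge[OF e12] x1 by (metis j_def Q_def)
    have "x (Spine (Suc s)) i = x (Spine s) i" using x2 ij by (metis fun_upd_other fun_upd_same)
    then show "x (Spine s) i * x t3 i =
        mpoly_eval rconst ((x t)(i := x (Spine s) i, j := x (Spine (Suc s)) j)) R"
      using exchange_edge[OF e23] x2 l23 by (metis R_def)
    show "X \<in> laurent_ring UNIV ((x t)(i := x (Spine s) i))" using assms(7) x1 by metis
    show "X \<in> laurent_ring UNIV ((x t)(i := x t3 i, j := x (Spine (Suc s)) j))" using assms(8) x3 by metis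
  qed
qed

text \<open>When the \<open>i\<close>-neighbour of \<open>Spine (Suc s)\<close> happens to be the next spine vertex, the induction
  hypothesis is applied two steps further along the spine.\<close>

lemma laurent_ring_caterpillar:
  assumes "1 \<le> s" "s \<le> r" "r \<le> m" "edge t (Spine s)" "s < r \<Longrightarrow> t \<noteq> Spine (Suc s)"
    "t' = Spine r \<or> edge t' (Spine r)"
  shows "x t' k \<in> laurent_ring UNIV (x t)"
  using assms
proof (induction "r - s" arbitrary: s t rule: less_induct)
  case less
  show ?case
  proof (cases "s = r")
    case True
    then show ?thesis
      using less.prems laurent_ring_two_edges[of t s t'] laurent_ring_edge[of t "Spine s"]
        indep_at_spine[of t s] by auto
  next
    case False
    then have sr: "s < r" using less.prems by simp
    obtain t3 where t3: "edge t3 (Spine (Suc s))" "label {t3, Spine (Suc s)} = label {t, Spine s}"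
      using edge_label_exists[of "Suc s" "label {t, Spine s}"] sr less.prems by auto
    \<comment> \<open>The vertex \<open>Spine s\<close> is itself a neighbour of
      \<open>Spine (Suc s)\<close>, so the induction hypothesis applies with it as starting
      vertex.\<close>
    have "x t' k \<in> laurent_ring UNIV (x (Spine s))"
      using less.prems sr edge_spine[of s] by (intro less.hyps[of "Suc s"]) auto
    moreover have "x t' k \<in> laurent_ring UNIV (x t3)"
    proof (cases "Suc s < r \<and> t3 = Spine (Suc (Suc s))")
      case False
      then show ?thesis using less.prems sr t3 by (intro less.hyps[of "Suc s"]) auto
    next
      case next_spine: True
      show ?thesis
      \<comment> \<open>In this case \<open>t3\<close> is \<open>Spine r\<close>, so the target is
        \<open>t3\<close> itself or one exchange away; there is no further spine vertex from which
        to apply the hypothesis.\<close>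
      proof (cases "r = Suc (Suc s)")
        case True
        then have "t' = t3 \<or> edge t3 t'" using less.prems next_spine edge_sym by auto
        then show ?thesis
          using laurent_ring_edge indep_at_spine[of t3 "Suc s"] t3 less.prems sr
            var_in_laurent_ring[of k UNIV "x t3"] by auto
      next
        case False
        then have "edge t3 (Spine (Suc (Suc (Suc s))))"
          using next_spine less.prems edge_spine[of "Suc (Suc s)"] by simp
        then show ?thesis
          using less.prems sr next_spine False by (intro less.hyps[of "Suc (Suc (Suc s))"]) auto
      qed
    qed
    ultimately show ?thesis
      using laurent_ring_intersection[of s t t3] less.prems sr t3 by auto
  qed
qed

theorem laurent_phenomenon:
  assumes "t \<in> tree_vertices CARD('n) m"
  shows "laurent_polynomial_in (x Tail) (x t i)"
proof -
  obtain r where r: "1 \<le> r" "r \<le> m" "t = Spine r \<or> edge t (Spine r)"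
  proof -
    consider "t = Tail" | "t = Head" | s where "t = Spine s" "1 \<le> s" "s \<le> m"
      | s k where "t = Leaf s k" "1 \<le> s" "s \<le> m" "k < CARD('n) - 2"
      using assms by (auto simp: tree_vertices_def)
    then show ?thesis
    proof cases
      case 1
      then show ?thesis using that[of 1] edge_Tail m_ge_1 by simp
    next
      case 2
      have "edge Head (Spine m)" by (simp add: edge_def tree_edges_def insert_commute)
      then show ?thesis using that[of m] 2 m_ge_1 by simp
    next
      case 3
      then show ?thesis using that by blast
    next
      case 4
      have "edge (Spine s) (Leaf s k)" using 4 unfolding edge_def tree_edges_def by auto
      then show ?thesis using that[of s] 4 edge_sym by blast
    qed
  qed
  have "x t i \<in> laurent_ring UNIV (x Tail)"
    using laurent_ring_caterpillar[OF _ r(1,2) edge_Tail _ r(3)] by simp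
  moreover have "x Tail k \<noteq> 0" for k by (simp add: initial_cluster)
  ultimately show ?thesis by (intro laurent_polynomial_in_of_laurent_ring)
qed

end

theorem theorem2p1:
  fixes m :: nat
    and label :: "vertex set \<Rightarrow> 'n::{finite,linorder}"
    and pol :: "vertex set \<Rightarrow> ('n, 'a::{factorial_semiring,idom}) mpoly"
    and x :: "vertex \<Rightarrow> 'n \<Rightarrow> ('n, 'a) ratfun"
  assumes n_ge_2: "CARD('n) \<ge> 2"
    and m_ge_1: "m \<ge> 1"
    and label_distinct:
      "\<And>s. s \<in> {1..m} \<Longrightarrow> inj_on label {e \<in> tree_edges CARD('n) m. Spine s \<in> e}"
    and pol_nonzero: "\<And>e. e \<in> tree_edges CARD('n) m \<Longrightarrow> pol e \<noteq> 0"
    and initial_cluster: "\<And>i. x Tail i = rvar i"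
    and exchange_fixed:
      "\<And>t t' i. {t, t'} \<in> tree_edges CARD('n) m \<Longrightarrow> i \<noteq> label {t, t'} \<Longrightarrow> x t i = x t' i"
    and exchange:
      "\<And>t t' k. {t, t'} \<in> tree_edges CARD('n) m \<Longrightarrow> k = label {t, t'} \<Longrightarrow>
         x t k * x t' k = mpoly_eval rconst (x t) (pol {t, t'})"
    and cond1:
      "\<And>e. e \<in> tree_edges CARD('n) m \<Longrightarrow>
         \<not> depends_on (pol e) (label e) \<and> (\<forall>i. \<not> mvar i dvd pol e)"
    and cond2:
      "\<And>t t' t'' i. {t, t'} \<in> tree_edges CARD('n) m \<Longrightarrow> spine_arc m t' t'' \<Longrightarrow> t \<noteq> t'' \<Longrightarrow>
         i = label {t, t'} \<Longrightarrow>
         coprime_elems (pol {t, t'}) (set_zero i (pol {t', t''}))"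
    and cond3:
      "\<And>t t' t'' t''' i j P Q0 R.
         {t, t'} \<in> tree_edges CARD('n) m \<Longrightarrow> spine_arc m t' t'' \<Longrightarrow>
         {t'', t'''} \<in> tree_edges CARD('n) m \<Longrightarrow>
         distinct [{t, t'}, {t', t''}, {t'', t'''}] \<Longrightarrow>
         label {t, t'} = i \<Longrightarrow> label {t', t''} = j \<Longrightarrow> label {t'', t'''} = i \<Longrightarrow>
         P = pol {t, t'} \<Longrightarrow> Q0 = set_zero i (pol {t', t''}) \<Longrightarrow> R = pol {t'', t'''} \<Longrightarrow>
         \<exists>(b::nat) c \<alpha>. coprime_elems (mconst c) P \<and>
           laurent_monomial c \<alpha> rvar * to_fract Q0 ^ b * to_fract P
             = subst_var j (to_fract Q0 / rvar j) R"
  shows "\<forall>t \<in> tree_vertices CARD('n) m. \<forall>i. laurent_polynomial_in (x Tail) (x t i)"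
proof -
  interpret exchange_pattern m label pol x
    by (rule exchange_pattern.intro) (fact assms)+
  show ?thesis using laurent_phenomenon by blast
qed

end
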